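(* Let $\mathcal G=(G,\omega)$ be an arbitrary filling of a finite pseudo-metric space $\mathcal M=(M,\rho)$ with $|M|\ge2$, where $G$ is a tree whose vertices of degree $1$ and $2$ all belong to $M$. Then $\omega(G)\ge p(\mathcal M,\pi)$ for every $\pi\in\mathcal O(G)$; in other words, $$\omega(G)\ge\max_{\pi\in\mathcal O(G)}p(\mathcal M,\pi),$$ and hence $$\mathrm{mf}(\mathcal M)\ge\min_{G'}\max_{\pi\in\mathcal O(G')}p(\mathcal M,\pi)\ge p(\mathcal M),$$ where the minimum can be taken either over all trees $G'$ with boundary $M$ (whose vertices of degree $1$ and $2$ all belong to $M$), or only over all binary trees $G'$ with boundary $M$. Further, if $$\omega(G)=\max_{\pi\in\mathcal O(G)}p(\mathcal M,\pi),$$ then $\mathcal G$ is a minimal parametric filling, and $$\mathrm{mpf}(\mathcal M,G)=\max_{\pi\in\mathcal O(G)}p(\mathcal M,\pi).$$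
   Context: In a pseudo-metric space the distance between distinct points may be $0$. A finite graph $G=(V,E)$ joins $M$ (has boundary $M$) if it is connected and $M\subset V$. For a weight function $\omega:E\to[0,\infty)$, $d_\omega(u,v)$ is the least weight (sum of $\omega$ over edges) of a path in $G$ joining $u$ and $v$, and $\omega(G)=\sum_{e\in E}\omega(e)$. The weighted graph $(G,\omega)$ is a filling of $\mathcal M=(M,\rho)$ of type $G$ if $G$ joins $M$ and $\rho(p,q)\le d_\omega(p,q)$ for all $p,q\in M$. $\mathrm{mf}(\mathcal M)$ is the infimum of $\omega(G)$ over all fillings of $\mathcal M$ (over all $G$); $\mathrm{mpf}(\mathcal M,G)$ is the infimum of $\omega(G)$ over all fillings $(G,\omega)$ of the fixed type $G$; a minimal parametric filling is a filling $(G,\omega)$ with $\omega(G)=\mathrm{mpf}(\mathcal M,G)$. A binary tree is a tree all of whose vertices have degree $1$ or $3$ and whose boundary is exactly the set of vertices of degree $1$. Let $G=(V,E)$ be a tree with boundary $M$. For $e\in E$, let $G_1,G_2$ be the connected components of $G$ with $e$ removed, and $\mathcal P_G(e)=\{M_1,M_2\}$, where $M_i$ is the set of points of $M$ lying in $G_i$. A cyclic order on $M$ is a cyclic permutation $\pi:M\to M$ (a single cycle through all of $M$). It is a tour of $G$ (planar with respect to $G$) if for every $e\in E$ and each $M_i\in\mathcal P_G(e)$ there is a unique $p\in M_i$ with $\pi(p)\notin M_i$. $\mathcal O(G)$ is the set of all tours of $G$. The half-perimeter of $\mathcal M$ with respect to a cyclic order $\pi$ is $p(\mathcal M,\pi)=\frac12\sum_{x\in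 M}\rho(x,\pi(x))$, and the half-perimeter of $\mathcal M$ is $p(\mathcal M)=\min_\pi p(\mathcal M,\pi)$ over all cyclic orders $\pi$ on $M$. *)

theory Defs
  imports Complex_Main "HOL-Combinatorics.Permutations" "HOL-Combinatorics.Orbits"
begin

text \<open>
  A graph is given by its vertex set \<open>V\<close> and its set \<open>E\<close> of undirected edges (two-element sets of
  vertices). The points of the pseudo-metric space and the vertices of the graphs have the same
  type \<open>'a\<close>, so that a graph joining \<open>M\<close> literally satisfies \<open>M \<subseteq> V\<close>; quantities ranging over all
  graphs, such as \<open>mf\<close>, have their intended meaning when \<open>'a\<close> is infinite, i.e. when there are
  always enough additional vertices available.
\<close>

definition pseudo_metric_on :: "'a set \<Rightarrow> ('a \<Rightarrow> 'a \<Rightarrow> real) \<Rightarrow> bool" where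
  "pseudo_metric_on M \<rho> \<longleftrightarrow>
     (\<forall>x\<in>M. \<rho> x x = 0) \<and>
     (\<forall>x\<in>M. \<forall>y\<in>M. 0 \<le> \<rho> x y) \<and>
     (\<forall>x\<in>M. \<forall>y\<in>M. \<rho> x y = \<rho> y x) \<and>
     (\<forall>x\<in>M. \<forall>y\<in>M. \<forall>z\<in>M. \<rho> x z \<le> \<rho> x y + \<rho> y z)"


subsection \<open>Finite simple graphs\<close>

definition finite_graph :: "'a set \<Rightarrow> 'a set set \<Rightarrow> bool" where
  "finite_graph V E \<longleftrightarrow> finite V \<and> E \<subseteq> {e. e \<subseteq> V \<and> card e = 2}"

definition is_path :: "'a set \<Rightarrow> 'a set set \<Rightarrow> 'a list \<Rightarrow> bool" where
  "is_path V E vs \<longleftrightarrow>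
     vs \<noteq> [] \<and> distinct vs \<and> set vs \<subseteq> V \<and> successively (\<lambda>u v. {u, v} \<in> E) vs"

definition paths_between :: "'a set \<Rightarrow> 'a set set \<Rightarrow> 'a \<Rightarrow> 'a \<Rightarrow> 'a list set" where
  "paths_between V E u v = {vs. is_path V E vs \<and> hd vs = u \<and> last vs = v}"

definition connected_graph :: "'a set \<Rightarrow> 'a set set \<Rightarrow> bool" where
  "connected_graph V E \<longleftrightarrow> finite_graph V E \<and> (\<forall>u\<in>V. \<forall>v\<in>V. paths_between V E u v \<noteq> {})"

definition is_cycle :: "'a set \<Rightarrow> 'a set set \<Rightarrow> 'a list \<Rightarrow> bool" where
  "is_cycle V E vs \<longleftrightarrow> is_path V E vs \<and> 3 \<le> length vs \<and> {last vs, hd vs} \<in> E"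

definition tree_graph :: "'a set \<Rightarrow> 'a set set \<Rightarrow> bool" where
  "tree_graph V E \<longleftrightarrow> connected_graph V E \<and> (\<nexists>vs. is_cycle V E vs)"

definition degree :: "'a set set \<Rightarrow> 'a \<Rightarrow> nat" where
  "degree E v = card {e \<in> E. v \<in> e}"

definition components_of_graph :: "'a set \<Rightarrow> 'a set set \<Rightarrow> 'a set set" where
  "components_of_graph V E = (\<lambda>u. {v \<in> V. paths_between V E u v \<noteq> {}}) ` V"

definition joins :: "'a set \<Rightarrow> 'a set set \<Rightarrow> 'a set \<Rightarrow> bool" where
  "joins V E M \<longleftrightarrow> connected_graph V E \<and> M \<subseteq> V"

definition boundary_tree :: "'a set \<Rightarrow> 'a set \<Rightarrow> 'a set set \<Rightarrow> bool" where
  "boundary_tree M V E \<longleftrightarrow>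
     tree_graph V E \<and> joins V E M \<and> (\<forall>v\<in>V. degree E v = 1 \<or> degree E v = 2 \<longrightarrow> v \<in> M)"

definition binary_tree :: "'a set \<Rightarrow> 'a set \<Rightarrow> 'a set set \<Rightarrow> bool" where
  "binary_tree M V E \<longleftrightarrow>
     tree_graph V E \<and> (\<forall>v\<in>V. degree E v = 1 \<or> degree E v = 3) \<and> M = {v \<in> V. degree E v = 1}"


subsection \<open>Fillings\<close>

definition path_weight :: "('a set \<Rightarrow> real) \<Rightarrow> 'a list \<Rightarrow> real" where
  "path_weight \<omega> vs = (\<Sum>i<length vs - 1. \<omega> {vs ! i, vs ! Suc i})"

definition graph_dist :: "'a set \<Rightarrow> 'a set set \<Rightarrow> ('a set \<Rightarrow> real) \<Rightarrow> 'a \<Rightarrow> 'a \<Rightarrow> real" where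
  "graph_dist V E \<omega> u v = Min (path_weight \<omega> ` paths_between V E u v)"

definition graph_weight :: "'a set set \<Rightarrow> ('a set \<Rightarrow> real) \<Rightarrow> real" where
  "graph_weight E \<omega> = (\<Sum>e\<in>E. \<omega> e)"

definition filling ::
    "'a set \<Rightarrow> ('a \<Rightarrow> 'a \<Rightarrow> real) \<Rightarrow> 'a set \<Rightarrow> 'a set set \<Rightarrow> ('a set \<Rightarrow> real) \<Rightarrow> bool" where
  "filling M \<rho> V E \<omega> \<longleftrightarrow>
     joins V E M \<and> (\<forall>e\<in>E. 0 \<le> \<omega> e) \<and> (\<forall>p\<in>M. \<forall>q\<in>M. \<rho> p q \<le> graph_dist V E \<omega> p q)"

definition mf :: "'a set \<Rightarrow> ('a \<Rightarrow> 'a \<Rightarrow> real) \<Rightarrow> real" where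
  "mf M \<rho> = Inf {graph_weight E \<omega> | V E \<omega>. filling M \<rho> V E \<omega>}"

definition mpf :: "'a set \<Rightarrow> ('a \<Rightarrow> 'a \<Rightarrow> real) \<Rightarrow> 'a set \<Rightarrow> 'a set set \<Rightarrow> real" where
  "mpf M \<rho> V E = Inf {graph_weight E \<omega> | \<omega>. filling M \<rho> V E \<omega>}"

definition minimal_parametric_filling ::
    "'a set \<Rightarrow> ('a \<Rightarrow> 'a \<Rightarrow> real) \<Rightarrow> 'a set \<Rightarrow> 'a set set \<Rightarrow> ('a set \<Rightarrow> real) \<Rightarrow> bool" where
  "minimal_parametric_filling M \<rho> V E \<omega> \<longleftrightarrow>
     filling M \<rho> V E \<omega> \<and> graph_weight E \<omega> = mpf M \<rho> V E"


subsection \<open>Tours and half-perimeters\<close>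

text \<open>
  A map \<open>M \<Rightarrow> M\<close> is represented by its extension by the identity outside \<open>M\<close> (\<open>permutes\<close>), so
  that there are only finitely many cyclic orders on a finite set.
\<close>

definition cyclic_order :: "'a set \<Rightarrow> ('a \<Rightarrow> 'a) \<Rightarrow> bool" where
  "cyclic_order M \<pi> \<longleftrightarrow> \<pi> permutes M \<and> cyclic_on \<pi> M"

definition edge_parts :: "'a set \<Rightarrow> 'a set \<Rightarrow> 'a set set \<Rightarrow> 'a set \<Rightarrow> 'a set set" where
  "edge_parts M V E e = (\<lambda>C. M \<inter> C) ` components_of_graph V (E - {e})"

definition tours :: "'a set \<Rightarrow> 'a set \<Rightarrow> 'a set set \<Rightarrow> ('a \<Rightarrow> 'a) set" where
  "tours M V E =
     {\<pi>. cyclic_order M \<pi> \<and>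
         (\<forall>e\<in>E. \<forall>A\<in>edge_parts M V E e. \<exists>!p. p \<in> A \<and> \<pi> p \<notin> A)}"

definition half_perimeter_wrt :: "'a set \<Rightarrow> ('a \<Rightarrow> 'a \<Rightarrow> real) \<Rightarrow> ('a \<Rightarrow> 'a) \<Rightarrow> real" where
  "half_perimeter_wrt M \<rho> \<pi> = (\<Sum>x\<in>M. \<rho> x (\<pi> x)) / 2"

definition half_perimeter :: "'a set \<Rightarrow> ('a \<Rightarrow> 'a \<Rightarrow> real) \<Rightarrow> real" where
  "half_perimeter M \<rho> = Min (half_perimeter_wrt M \<rho> ` {\<pi>. cyclic_order M \<pi>})"

definition max_tour_half_perimeter ::
    "'a set \<Rightarrow> ('a \<Rightarrow> 'a \<Rightarrow> real) \<Rightarrow> 'a set \<Rightarrow> 'a set set \<Rightarrow> real" where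
  "max_tour_half_perimeter M \<rho> V E = Max (half_perimeter_wrt M \<rho> ` tours M V E)"

text \<open>
  For infinite \<open>'a\<close> there are infinitely many trees below, but only finitely many values: each one
  is the half-perimeter of \<open>M\<close> with respect to some cyclic order. Hence \<open>Min\<close> is meaningful.
\<close>

definition minimax_trees :: "'a set \<Rightarrow> ('a \<Rightarrow> 'a \<Rightarrow> real) \<Rightarrow> real" where
  "minimax_trees M \<rho> = Min {max_tour_half_perimeter M \<rho> V E | V E. boundary_tree M V E}"

definition minimax_binary_trees :: "'a set \<Rightarrow> ('a \<Rightarrow> 'a \<Rightarrow> real) \<Rightarrow> real" where
  "minimax_binary_trees M \<rho> = Min {max_tour_half_perimeter M \<rho> V E | V E. binary_tree M V E}"

end

theory Submission
  imports Defs "HOL-Combinatorics.Cycles"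
begin

text \<open>
  Let \<open>(G, \<omega>)\<close> be a filling whose graph is a tree. The distance between \<open>x\<close> and \<open>\<pi> x\<close> is the sum
  of the weights of the edges that separate these points. A tour \<open>\<pi>\<close> leaves each of the two parts
  belonging to an edge exactly once, so the sum of these distances over all \<open>x\<close> counts every edge
  twice. This gives \<open>p(M, \<pi>) \<le> \<omega>(G)\<close> (lemma \<open>half_perimeter_le_weight\<close>), and the assertion on
  minimal parametric fillings follows at once, provided that tours exist.

  Everything else rests on comparing trees by the splittings of \<open>M\<close> which their edges induce, since
  these determine the tours. Fix \<open>r \<in> M\<close> and represent each splitting by its part that does not
  contain \<open>r\<close>. The parts coming from one tree form a laminar family (lemma \<open>cuts_laminar\<close>), and
  each laminar family on \<open>M - {r}\<close> is contained in the family of leaf sets of the subtrees of a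
  rooted binary tree (lemma \<open>laminar_binary_tree\<close>). Joining the root to \<open>r\<close> gives a
  binary tree with boundary \<open>M\<close> that induces all splittings of the given tree, so that its tours are
  also planar with respect to the given tree; and its leaves from left to right, together with \<open>r\<close>,
  show that it has a tour (lemma \<open>binary_refinement\<close>).

  Consequently every tree with boundary \<open>M\<close> has tours, and the minimax over binary trees is at most
  the one over all trees; the converse is trivial. For the bound on \<open>mf\<close>, an arbitrary filling is
  restricted to a spanning tree. Leaves outside \<open>M\<close> need not be pruned and vertices of degree \<open>2\<close>
  need not be suppressed: the estimate for \<open>\<pi>\<close> requires planarity only with respect to the edges
  that split \<open>M\<close> nontrivially, and a binary tree refining just these splittings is still available.
\<close>

section \<open>Edge boundaries, components and bridges\<close>

text \<open>
  The edges with exactly one end in \<open>S\<close>. Connectedness and acyclicity are used only through these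
  edge boundaries: a graph is connected iff no nontrivial vertex set has an empty boundary, and a
  connected graph is a tree iff every edge is the whole boundary of some vertex set.
\<close>

definition cut :: "'a set set \<Rightarrow> 'a set \<Rightarrow> 'a set set" where
  "cut E S = {e \<in> E. e \<inter> S \<noteq> {} \<and> \<not> e \<subseteq> S}"

lemma pair_in_cut [simp]: "{a, b} \<in> cut E S \<longleftrightarrow> {a, b} \<in> E \<and> (a \<in> S) \<noteq> (b \<in> S)"
  by (auto simp: cut_def)

lemma cut_Un: "cut (E \<union> F) S = cut E S \<union> cut F S"
  by (auto simp: cut_def)

lemma finite_graphE:
  assumes "finite_graph V E" "e \<in> E"
  obtains a b where "e = {a, b}" "a \<noteq> b" "a \<in> V" "b \<in> V"
  using assms unfolding finite_graph_def by (auto simp: card_2_iff)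

lemma finite_edges: "finite_graph V E \<Longrightarrow> finite E"
  unfolding finite_graph_def by (rule finite_subset[of _ "Pow V"]) auto

lemma finite_graph_mono: "finite_graph V E \<Longrightarrow> F \<subseteq> E \<Longrightarrow> finite_graph V F"
  unfolding finite_graph_def by blast

lemma cut_compl:
  assumes "finite_graph V E"
  shows "cut E (V - S) = cut E S"
proof -
  have "e \<subseteq> V" if "e \<in> E" for e
    using assms that unfolding finite_graph_def by blast
  then show ?thesis
    unfolding cut_def by blast
qed

lemma cut_singleton:
  assumes "finite_graph V E"
  shows "cut E {v} = {e \<in> E. v \<in> e}"
proof -
  have "\<not> e \<subseteq> {v}" if "e \<in> E" for e
    using finite_graphE[OF assms that] by fastforce
  then show ?thesis
    unfolding cut_def by blast
qed

lemma is_path_nth_edge: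
  assumes "is_path V E vs" "Suc i < length vs"
  shows "{vs ! i, vs ! Suc i} \<in> E"
  using assms unfolding is_path_def by (auto simp: successively_conv_nth)

lemma is_path_mono: "is_path V E vs \<Longrightarrow> V \<subseteq> W \<Longrightarrow> E \<subseteq> F \<Longrightarrow> is_path W F vs"
  unfolding is_path_def by (auto intro: successively_mono)

lemma paths_between_mono: "V \<subseteq> W \<Longrightarrow> E \<subseteq> F \<Longrightarrow> paths_between V E u v \<subseteq> paths_between W F u v"
  unfolding paths_between_def by (auto intro: is_path_mono)

lemma same_side_along:
  assumes "i \<le> j" "\<And>k. i \<le> k \<Longrightarrow> k < j \<Longrightarrow> (vs ! k \<in> S) = (vs ! Suc k \<in> S)"
  shows "(vs ! i \<in> S) = (vs ! j \<in> S)"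
  using assms by (induction j rule: dec_induct) auto

lemma path_crosses_cut:
  assumes "is_path V E vs" "(hd vs \<in> S) \<noteq> (last vs \<in> S)"
  obtains i where "Suc i < length vs" "{vs ! i, vs ! Suc i} \<in> cut E S"
proof -
  have "vs \<noteq> []"
    using assms(1) by (simp add: is_path_def)
  then have "(vs ! 0 \<in> S) \<noteq> (vs ! (length vs - 1) \<in> S)"
    using assms(2) by (simp add: hd_conv_nth last_conv_nth)
  then obtain k where "k < length vs - 1" "(vs ! k \<in> S) \<noteq> (vs ! Suc k \<in> S)"
    using same_side_along[of 0 "length vs - 1" vs S] by blast
  moreover from this have "{vs ! k, vs ! Suc k} \<in> E"
    using is_path_nth_edge[OF assms(1)] by simp
  ultimately show ?thesis
    using that[of k] by simp
qed

text \<open>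
  The connected component of \<open>u\<close>: by the two lemmas on boundaries below, the least set that contains
  \<open>u\<close> and has no boundary.
\<close>

definition component :: "'a set \<Rightarrow> 'a set set \<Rightarrow> 'a \<Rightarrow> 'a set" where
  "component V E u = {v \<in> V. paths_between V E u v \<noteq> {}}"

lemma component_subset: "component V E u \<subseteq> V"
  by (auto simp: component_def)

lemma self_in_component:
  assumes "u \<in> V"
  shows "u \<in> component V E u"
proof -
  have "[u] \<in> paths_between V E u u"
    using assms by (simp add: paths_between_def is_path_def)
  then show ?thesis
    using assms by (auto simp: component_def)
qed

lemma cut_component:
  assumes "finite_graph V E"
  shows "cut E (component V E u) = {}"
proof -
  have closed: "b \<in> component V E u" if ab: "{a, b} \<in> E" and a: "a \<in> component V E u" for a b
  proof -
    have "b \<in> V"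
      using ab assms unfolding finite_graph_def by blast
    obtain vs where vs: "is_path V E vs" "hd vs = u" "last vs = a"
      using a by (auto simp: component_def paths_between_def)
    have "\<exists>ws. is_path V E ws \<and> hd ws = u \<and> last ws = b"
    proof (cases "b \<in> set vs")
      case True
      then obtain xs ys where "vs = xs @ b # ys"
        by (meson split_list)
      then have "is_path V E (xs @ [b])"
        using vs(1) unfolding \<open>vs = xs @ b # ys\<close> is_path_def
        by (auto simp: successively_append_iff)
      moreover have "hd (xs @ [b]) = u"
        using \<open>vs = xs @ b # ys\<close> vs(2) by (cases xs) auto
      ultimately show ?thesis
        by (intro exI[of _ "xs @ [b]"]) simp
    next
      case False
      then have "is_path V E (vs @ [b])" "hd (vs @ [b]) = u"
        using vs ab \<open>b \<in> V\<close> False by (auto simp: is_path_def successively_append_iff)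
      then show ?thesis
        by (intro exI[of _ "vs @ [b]"]) simp
    qed
    then show ?thesis
      using \<open>b \<in> V\<close> by (auto simp: component_def paths_between_def)
  qed
  have "e \<notin> cut E (component V E u)" if e: "e \<in> E" for e
  proof -
    obtain a b where ab: "e = {a, b}"
      using finite_graphE[OF assms e] by blast
    then show ?thesis
      using closed[of a b] closed[of b a] e by (auto simp: insert_commute)
  qed
  then show ?thesis
    by (auto simp: cut_def)
qed

lemma component_least:
  assumes "u \<in> S" "cut E S = {}"
  shows "component V E u \<subseteq> S"
proof
  fix v assume "v \<in> component V E u"
  then obtain vs where "is_path V E vs" "hd vs = u" "last vs = v"
    by (auto simp: component_def paths_between_def)
  then show "v \<in> S"
    using assms path_crosses_cut[of V E vs S] by (metis empty_iff)
qed

lemma connected_graph_iff_cut: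
  "connected_graph V E \<longleftrightarrow> finite_graph V E \<and> (\<forall>S\<subseteq>V. cut E S = {} \<longrightarrow> S = {} \<or> S = V)"
proof (intro iffI conjI allI impI)
  assume conn: "connected_graph V E"
  then show "finite_graph V E"
    by (simp add: connected_graph_def)
  fix S assume "S \<subseteq> V" and S: "cut E S = {}"
  have "V \<subseteq> S" if "u \<in> S" for u
  proof -
    have "V \<subseteq> component V E u"
      using conn that \<open>S \<subseteq> V\<close> by (auto simp: connected_graph_def component_def)
    then show ?thesis
      using component_least[OF that S] by blast
  qed
  then show "S = {} \<or> S = V"
    using \<open>S \<subseteq> V\<close> by blast
next
  assume *: "finite_graph V E \<and> (\<forall>S\<subseteq>V. cut E S = {} \<longrightarrow> S = {} \<or> S = V)"
  have "component V E u = V" if "u \<in> V" for u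
    using * cut_component[of V E u] self_in_component[OF that, of E] component_subset[of V E u] by blast
  then show "connected_graph V E"
    using * by (auto simp: connected_graph_def component_def)
qed

lemma connected_cut_nonempty:
  assumes "connected_graph V E" "S \<subseteq> V" "S \<noteq> {}" "S \<noteq> V"
  shows "cut E S \<noteq> {}"
  using assms by (auto simp: connected_graph_iff_cut)

text \<open>
  If \<open>e\<close> is the only edge leaving \<open>A\<close>, both sides stay connected once \<open>e\<close> is removed: a component
  missing the end of \<open>e\<close> on its own side would already have an empty boundary in the whole graph.
\<close>

lemma components_of_bridge:
  assumes conn: "connected_graph V E" and A: "A \<subseteq> V" and e: "cut E A = {e}"
  shows "components_of_graph V (E - {e}) = {A, V - A}"
proof -
  have fin: "finite_graph V E" and fin': "finite_graph V (E - {e})"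
    using conn by (auto simp: connected_graph_def intro: finite_graph_mono)
  have side: "component V (E - {e}) u = B"
    if B: "B \<subseteq> V" "cut E B = {e}" and u: "u \<in> B" for B u
  proof -
    let ?C = "component V (E - {e}) u"
    have "e \<in> E" "e \<inter> B \<noteq> {}" "\<not> e \<subseteq> B"
      using B by (auto simp: cut_def)
    then obtain a b where ab: "e = {a, b}" "a \<in> B" "b \<notin> B"
    proof -
      obtain x y where "e = {x, y}"
        using finite_graphE[OF fin \<open>e \<in> E\<close>] .
      then show ?thesis
        using that[of x y] that[of y x] \<open>e \<inter> B \<noteq> {}\<close> \<open>\<not> e \<subseteq> B\<close> by (auto simp: insert_commute)
    qed
    have least: "component V (E - {e}) w \<subseteq> B" if "w \<in> B" for w
      using component_least[of w B "E - {e}" V] B that by (auto simp: cut_def)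
    \<comment> \<open>Every component inside \<open>B\<close> contains the end \<open>a\<close> of \<open>e\<close>, so there is only one.\<close>
    have a_in: "a \<in> component V (E - {e}) w" if w: "w \<in> B" for w
    proof (rule ccontr)
      assume "a \<notin> component V (E - {e}) w"
      then have "cut E (component V (E - {e}) w) = cut (E - {e}) (component V (E - {e}) w)"
        using ab least[OF w] by (auto simp: cut_def)
      also have "\<dots> = {}"
        by (rule cut_component[OF fin'])
      finally have "component V (E - {e}) w = V"
        using connected_cut_nonempty[OF conn component_subset, of "E - {e}" w]
          self_in_component[of w V "E - {e}"] w B(1) by auto
      then show False
        using \<open>a \<notin> component V (E - {e}) w\<close> ab B by blast
    qed
    have "B \<subseteq> ?C"
    proof
      fix w assume w: "w \<in> B"
      show "w \<in> ?C"
      proof (rule ccontr)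
        assume "w \<notin> ?C"
        have "cut (E - {e}) (V - ?C) = {}"
          using cut_compl[OF fin'] cut_component[OF fin'] by metis
        then have "component V (E - {e}) w \<subseteq> V - ?C"
          using w B \<open>w \<notin> ?C\<close> by (intro component_least) auto
        then show False
          using a_in[OF w] a_in[OF u] by blast
      qed
    qed
    then show ?thesis
      using least[OF u] by blast
  qed
  have compl: "cut E (V - A) = {e}"
    using cut_compl[OF fin] e by metis
  have ne: "A \<noteq> {}" "V - A \<noteq> {}"
  proof -
    have "e \<in> cut E A" "e \<in> cut E (V - A)"
      unfolding e compl by simp_all
    then show "A \<noteq> {}" "V - A \<noteq> {}"
      unfolding cut_def by blast+
  qed
  have "components_of_graph V (E - {e}) = component V (E - {e}) ` V"
    by (simp add: components_of_graph_def component_def)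
  also have "\<dots> = component V (E - {e}) ` (A \<union> (V - A))"
    using A by (simp add: Un_absorb1)
  also have "component V (E - {e}) ` (A \<union> (V - A)) = (\<lambda>_. A) ` A \<union> (\<lambda>_. V - A) ` (V - A)"
    unfolding image_Un using side[OF A e] side[OF _ compl] by (auto simp: image_iff)
  finally show ?thesis
    using ne by auto
qed

lemma tree_graph_bridge:
  assumes "tree_graph V E" "e \<in> E"
  obtains A where "A \<subseteq> V" "cut E A = {e}"
proof -
  have fin: "finite_graph V E" and conn: "connected_graph V E"
    using assms by (auto simp: tree_graph_def connected_graph_def)
  obtain a b where ab: "e = {a, b}" "a \<noteq> b" "a \<in> V" "b \<in> V"
    using finite_graphE[OF fin assms(2)] .
  let ?A = "component V (E - {e}) a"
  have "cut (E - {e}) ?A = {}"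
    using cut_component finite_graph_mono[OF fin] by (metis Diff_subset)
  then have sub: "cut E ?A \<subseteq> {e}"
    by (auto simp: cut_def)
  \<comment> \<open>A path from \<open>a\<close> to \<open>b\<close> that avoids \<open>e\<close> would be closed to a cycle by \<open>e\<close>.\<close>
  have "b \<notin> ?A"
  proof
    assume "b \<in> ?A"
    then obtain vs where vs: "is_path V (E - {e}) vs" "hd vs = a" "last vs = b"
      by (auto simp: component_def paths_between_def)
    have "length vs \<noteq> 0" "length vs \<noteq> 1"
      using vs ab by (auto simp: is_path_def length_Suc_conv)
    moreover have "length vs \<noteq> 2"
      using vs ab by (auto simp: is_path_def length_Suc_conv numeral_2_eq_2)
    ultimately have "3 \<le> length vs"
      by linarith
    then have "is_cycle V E vs"
      using vs ab assms(2) is_path_mono[OF vs(1), of V E] by (auto simp: is_cycle_def insert_commute)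
    then show False
      using assms(1) by (auto simp: tree_graph_def)
  qed
  then have "e \<in> cut E ?A"
    using ab assms(2) self_in_component[of a V] by auto
  then show ?thesis
    using that[of ?A] sub component_subset by fastforce
qed

text \<open>
  The closing edge of a cycle is no bridge: the rest of the cycle joins its ends, hence crosses
  every vertex set that the edge crosses, and it does so in a different edge.
\<close>

lemma tree_graphI_bridges:
  assumes conn: "connected_graph V E" and bridge: "\<And>e. e \<in> E \<Longrightarrow> \<exists>A. cut E A = {e}"
  shows "tree_graph V E"
proof -
  have "\<not> is_cycle V E vs" for vs
  proof
    assume "is_cycle V E vs"
    then have p: "is_path V E vs" and len: "3 \<le> length vs" and e: "{last vs, hd vs} \<in> E"
      by (auto simp: is_cycle_def)
    obtain A where A: "cut E A = {{last vs, hd vs}}"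
      using bridge[OF e] by blast
    then have "(hd vs \<in> A) \<noteq> (last vs \<in> A)"
      by (metis pair_in_cut singletonI)
    then obtain i where i: "Suc i < length vs" "{vs ! i, vs ! Suc i} \<in> cut E A"
      using path_crosses_cut[OF p] by blast
    have "vs \<noteq> []" and d: "distinct vs"
      using p by (auto simp: is_path_def)
    have "{vs ! i, vs ! Suc i} = {vs ! (length vs - 1), vs ! 0}"
      using i A \<open>vs \<noteq> []\<close> by (simp add: hd_conv_nth last_conv_nth)
    then have "vs ! Suc i = vs ! (length vs - 1) \<and> vs ! i = vs ! 0 \<or> vs ! Suc i = vs ! 0"
      by (auto simp: doubleton_eq_iff)
    then show False
      using i(1) len nth_eq_iff_index_eq[OF d, of "Suc i" "length vs - 1"]
        nth_eq_iff_index_eq[OF d, of i 0] nth_eq_iff_index_eq[OF d, of "Suc i" 0] by linarith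
  qed
  then show ?thesis
    using conn by (auto simp: tree_graph_def)
qed

lemma edge_parts_bridge:
  assumes "connected_graph V E" "A \<subseteq> V" "cut E A = {e}" "M \<subseteq> V"
  shows "edge_parts M V E e = {M \<inter> A, M - A}"
  using assms by (auto simp: edge_parts_def components_of_bridge)

text \<open>
  Deleting an edge that is not a bridge keeps the graph connected.
\<close>

lemma spanning_tree:
  assumes "connected_graph V E"
  obtains F where "F \<subseteq> E" "tree_graph V F"
proof -
  have "finite E"
    using assms by (auto simp: connected_graph_def intro: finite_edges)
  then have "\<exists>F\<subseteq>E. tree_graph V F"
    using assms
  proof (induction E rule: finite_psubset_induct)
    case (psubset E)
    show ?case
    proof (cases "\<forall>e\<in>E. \<exists>A\<subseteq>V. cut E A = {e}")
      case True
      then have "tree_graph V E"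
        using tree_graphI_bridges[OF psubset.prems] by blast
      then show ?thesis
        by blast
    next
      case False
      then obtain e where e: "e \<in> E" "\<And>A. A \<subseteq> V \<Longrightarrow> cut E A \<noteq> {e}"
        by blast
      have "S = {} \<or> S = V" if S: "S \<subseteq> V" "cut (E - {e}) S = {}" for S
      proof -
        have "cut E S \<subseteq> {e}"
          using S by (auto simp: cut_def)
        then have "cut E S = {}"
          using e(2)[OF S(1)] by blast
        then show ?thesis
          using connected_cut_nonempty[OF psubset.prems S(1)] by blast
      qed
      moreover have "finite_graph V (E - {e})"
        using psubset.prems finite_graph_mono by (fastforce simp: connected_graph_def)
      ultimately have "connected_graph V (E - {e})"
        by (simp add: connected_graph_iff_cut)
      then show ?thesis
        using psubset.IH[of "E - {e}"] e(1) by blast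
    qed
  qed
  then show ?thesis
    using that by blast
qed

section \<open>Half-perimeter and weight of a tree\<close>

text \<open>
  A simple path in a tree consists of edges that separate its ends: it uses an edge \<open>e\<close> at most
  once, and only \<open>e\<close> leads from one side of the bridge \<open>e\<close> to the other. Here \<open>c e\<close> is a side
  of \<open>e\<close>.
\<close>

lemma path_weight_le_separating:
  assumes tree: "tree_graph V E" and nonneg: "\<forall>e\<in>E. 0 \<le> \<omega> e"
    and c: "\<And>e. e \<in> E \<Longrightarrow> cut E (c e) = {e}"
    and path: "vs \<in> paths_between V E p q"
  shows "path_weight \<omega> vs \<le> (\<Sum>e | e \<in> E \<and> (p \<in> c e) \<noteq> (q \<in> c e). \<omega> e)"
proof -
  have fin: "finite E"
    using tree by (auto simp: tree_graph_def connected_graph_def intro: finite_edges)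
  have vs: "is_path V E vs" "vs \<noteq> []" "distinct vs"
    and ends: "vs ! 0 = p" "vs ! (length vs - 1) = q"
    using path by (auto simp: paths_between_def is_path_def hd_conv_nth last_conv_nth)
  let ?n = "length vs - 1" and ?f = "\<lambda>i. {vs ! i, vs ! Suc i}"
  have inj: "inj_on ?f {..<?n}"
  proof (rule inj_onI)
    fix i j assume "i \<in> {..<?n}" "j \<in> {..<?n}" "?f i = ?f j"
    then show "i = j"
      using nth_eq_iff_index_eq[OF vs(3), of i j] nth_eq_iff_index_eq[OF vs(3), of "Suc i" j]
        nth_eq_iff_index_eq[OF vs(3), of i "Suc j"]
      unfolding doubleton_eq_iff lessThan_iff by linarith
  qed
  have "(p \<in> c (?f i)) \<noteq> (q \<in> c (?f i))" if i: "i < ?n" for i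
  proof -
    let ?A = "c (?f i)"
    have A: "cut E ?A = {?f i}"
      using is_path_nth_edge[OF vs(1), of i] i c by simp
    \<comment> \<open>No other edge of the path changes sides.\<close>
    have same: "(vs ! k \<in> ?A) = (vs ! Suc k \<in> ?A)" if "k < ?n" "k \<noteq> i" for k
    proof -
      have "?f k \<noteq> ?f i"
        using inj_onD[OF inj, of k i] i that by blast
      then have "?f k \<notin> cut E ?A"
        unfolding A by simp
      moreover have "?f k \<in> E"
        using is_path_nth_edge[OF vs(1), of k] that by simp
      ultimately show ?thesis
        unfolding pair_in_cut by simp
    qed
    have "(vs ! 0 \<in> ?A) = (vs ! i \<in> ?A)"
      by (rule same_side_along) (use i same in auto)
    moreover have "(vs ! Suc i \<in> ?A) = (vs ! ?n \<in> ?A)"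
      by (rule same_side_along) (use i same in auto)
    moreover have "?f i \<in> cut E ?A"
      unfolding A by simp
    then have "(vs ! i \<in> ?A) \<noteq> (vs ! Suc i \<in> ?A)"
      unfolding pair_in_cut by simp
    ultimately show ?thesis
      using ends by blast
  qed
  then have sub: "?f ` {..<?n} \<subseteq> {e. e \<in> E \<and> (p \<in> c e) \<noteq> (q \<in> c e)}"
    using is_path_nth_edge[OF vs(1)] by auto
  have "path_weight \<omega> vs = sum \<omega> (?f ` {..<?n})"
    unfolding path_weight_def by (subst sum.reindex[OF inj]) simp
  also have "\<dots> \<le> (\<Sum>e | e \<in> E \<and> (p \<in> c e) \<noteq> (q \<in> c e). \<omega> e)"
    by (rule sum_mono2) (use fin sub nonneg in auto)
  finally show ?thesis .
qed

lemma card_le_1_unique_exit: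
  assumes "M \<inter> A \<noteq> {} \<Longrightarrow> M - A \<noteq> {} \<Longrightarrow> \<exists>!p. p \<in> M \<inter> A \<and> \<pi> p \<notin> M \<inter> A" and "\<pi> permutes M"
  shows "card {x \<in> M. x \<in> A \<and> \<pi> x \<notin> A} \<le> 1"
proof (cases "M \<inter> A \<noteq> {} \<and> M - A \<noteq> {}")
  case True
  then obtain p where "\<And>x. x \<in> M \<inter> A \<and> \<pi> x \<notin> M \<inter> A \<Longrightarrow> x = p"
    using assms(1) by blast
  then have "{x \<in> M. x \<in> A \<and> \<pi> x \<notin> A} \<subseteq> {p}"
    by auto
  then show ?thesis
    using card_mono[of "{p}"] by simp
next
  case False
  then have "{x \<in> M. x \<in> A \<and> \<pi> x \<notin> A} = {}"
    using permutes_in_image[OF assms(2)] by auto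
  then show ?thesis
    by (simp del: Collect_empty_eq)
qed

text \<open>
  The cyclic orders that are planar with respect to those edges both of whose parts contain points
  of \<open>M\<close>. Unlike \<open>tours\<close>, this set is the right one for trees that have leaves outside \<open>M\<close>: an
  empty part has no point at which it could be left, so that such trees have no tours at all.
\<close>

definition tours_nontrivial :: "'a set \<Rightarrow> 'a set \<Rightarrow> 'a set set \<Rightarrow> ('a \<Rightarrow> 'a) set" where
  "tours_nontrivial M V E =
     {\<pi>. cyclic_order M \<pi> \<and>
         (\<forall>e\<in>E. {} \<notin> edge_parts M V E e \<longrightarrow>
            (\<forall>A\<in>edge_parts M V E e. \<exists>!p. p \<in> A \<and> \<pi> p \<notin> A))}"

lemma tours_subset_nontrivial: "tours M V E \<subseteq> tours_nontrivial M V E"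
  unfolding tours_def tours_nontrivial_def by blast

text \<open>
  The basic estimate: \<open>\<rho> x (\<pi> x)\<close> is at most the sum of the weights of the edges separating \<open>x\<close>
  from \<open>\<pi> x\<close>, and a tour passes every edge at most once in each direction, so that every edge is
  counted at most twice in the perimeter.
\<close>

lemma half_perimeter_le_weight:
  assumes tree: "tree_graph V E" and M: "M \<subseteq> V" and nonneg: "\<forall>e\<in>E. 0 \<le> \<omega> e"
    and \<rho>: "\<And>p q vs. p \<in> M \<Longrightarrow> q \<in> M \<Longrightarrow> vs \<in> paths_between V E p q \<Longrightarrow> \<rho> p q \<le> path_weight \<omega> vs"
    and \<pi>: "\<pi> \<in> tours_nontrivial M V E"
  shows "half_perimeter_wrt M \<rho> \<pi> \<le> graph_weight E \<omega>"
proof -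
  have conn: "connected_graph V E" and fin: "finite_graph V E"
    using tree by (auto simp: tree_graph_def connected_graph_def)
  have finE: "finite E" and finM: "finite M"
    using fin finite_edges M finite_subset by (auto simp: finite_graph_def)
  have perm: "\<pi> permutes M"
    using \<pi> by (simp add: tours_nontrivial_def cyclic_order_def)
  obtain c where c: "\<And>e. e \<in> E \<Longrightarrow> c e \<subseteq> V \<and> cut E (c e) = {e}"
  proof -
    have "\<forall>e\<in>E. \<exists>A. A \<subseteq> V \<and> cut E A = {e}"
      using tree_graph_bridge[OF tree] by metis
    from bchoice[OF this] obtain c where "\<forall>e\<in>E. c e \<subseteq> V \<and> cut E (c e) = {e}" ..
    then show ?thesis
      using that[of c] by simp
  qed
  have exit: "\<forall>e\<in>E. {} \<notin> edge_parts M V E e \<longrightarrow>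
      (\<forall>A\<in>edge_parts M V E e. \<exists>!p. p \<in> A \<and> \<pi> p \<notin> A)"
    using \<pi>[unfolded tours_nontrivial_def mem_Collect_eq] by (rule conjunct2)
  have count: "card {x \<in> M. (x \<in> c e) \<noteq> (\<pi> x \<in> c e)} \<le> 2" if e: "e \<in> E" for e
  proof -
    let ?A = "c e"
    have parts: "edge_parts M V E e = {M \<inter> ?A, M - ?A}"
      by (rule edge_parts_bridge[OF conn _ _ M]) (simp_all add: c[OF e])
    then have u: "\<exists>!p. p \<in> B \<and> \<pi> p \<notin> B"
      if "M \<inter> ?A \<noteq> {}" "M - ?A \<noteq> {}" "B = M \<inter> ?A \<or> B = M - ?A" for B
    proof -
      have "{} \<notin> edge_parts M V E e" "B \<in> edge_parts M V E e"
        unfolding parts using that by auto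
      then show ?thesis
        by (rule exit[rule_format, OF e])
    qed
    have "card {x \<in> M. x \<in> ?A \<and> \<pi> x \<notin> ?A} \<le> 1"
      using u[of "M \<inter> ?A"] by (intro card_le_1_unique_exit perm) simp
    moreover have "card {x \<in> M. x \<in> - ?A \<and> \<pi> x \<notin> - ?A} \<le> 1"
      using u[of "M - ?A"] by (intro card_le_1_unique_exit perm) (simp add: Diff_eq)
    moreover have "{x \<in> M. (x \<in> ?A) \<noteq> (\<pi> x \<in> ?A)} =
        {x \<in> M. x \<in> ?A \<and> \<pi> x \<notin> ?A} \<union> {x \<in> M. x \<in> - ?A \<and> \<pi> x \<notin> - ?A}"
      by auto
    ultimately show ?thesis
      using card_Un_le[of "{x \<in> M. x \<in> ?A \<and> \<pi> x \<notin> ?A}" "{x \<in> M. x \<in> - ?A \<and> \<pi> x \<notin> - ?A}"]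
      by simp
  qed
  have "\<rho> x (\<pi> x) \<le> (\<Sum>e\<in>E. if (x \<in> c e) \<noteq> (\<pi> x \<in> c e) then \<omega> e else 0)" if x: "x \<in> M" for x
  proof -
    have "\<pi> x \<in> M"
      using permutes_in_image[OF perm] x by blast
    then obtain vs where vs: "vs \<in> paths_between V E x (\<pi> x)"
      using conn x M by (fastforce simp: connected_graph_def)
    have "\<rho> x (\<pi> x) \<le> (\<Sum>e | e \<in> E \<and> (x \<in> c e) \<noteq> (\<pi> x \<in> c e). \<omega> e)"
      using \<rho>[OF x \<open>\<pi> x \<in> M\<close> vs] path_weight_le_separating[OF tree nonneg _ vs, of c] c
      by fastforce
    then show ?thesis
      using finE by (simp add: sum.inter_filter)
  qed
  then have "(\<Sum>x\<in>M. \<rho> x (\<pi> x)) \<le>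
      (\<Sum>x\<in>M. \<Sum>e\<in>E. if (x \<in> c e) \<noteq> (\<pi> x \<in> c e) then \<omega> e else 0)"
    by (rule sum_mono)
  also have "\<dots> = (\<Sum>e\<in>E. \<Sum>x\<in>M. if (x \<in> c e) \<noteq> (\<pi> x \<in> c e) then \<omega> e else 0)"
    by (rule sum.swap)
  also have "\<dots> = (\<Sum>e\<in>E. real (card {x \<in> M. (x \<in> c e) \<noteq> (\<pi> x \<in> c e)}) * \<omega> e)"
    by (rule sum.cong) (simp_all add: sum.inter_filter[OF finM, symmetric])
  also have "\<dots> \<le> (\<Sum>e\<in>E. 2 * \<omega> e)"
    using count nonneg by (intro sum_mono mult_right_mono) force+
  finally show ?thesis
    by (simp add: half_perimeter_wrt_def graph_weight_def sum_distrib_left[symmetric])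
qed

section \<open>Sides of the edges of a tree\<close>

lemma in_cutE:
  assumes "finite_graph V E" "e \<in> cut E S"
  obtains a b where "e = {a, b}" "a \<in> S" "b \<notin> S" "a \<in> V" "b \<in> V" "{a, b} \<in> E"
proof -
  have "e \<in> E"
    using assms(2) by (simp add: cut_def)
  then obtain x y where "e = {x, y}" "x \<in> V" "y \<in> V"
    using finite_graphE[OF assms(1)] by metis
  then show ?thesis
    using that[of x y] that[of y x] assms(2) by (auto simp: insert_commute)
qed

text \<open>
  Both sides of every edge of a tree contain a vertex of \<open>M\<close> when all vertices of degree \<open>1\<close> lie
  in \<open>M\<close>. If the end \<open>a\<close> of \<open>e\<close> in the side \<open>A\<close> has degree \<open>1\<close>, it is such a vertex; otherwise
  another edge at \<open>a\<close> has a side \<open>C\<close> not containing \<open>a\<close>, and \<open>C\<close> is strictly smaller than \<open>A\<close>.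
\<close>

lemma boundary_tree_meets_cut:
  assumes bt: "boundary_tree M V E" and "A \<subseteq> V" "cut E A = {e}"
  shows "M \<inter> A \<noteq> {}"
  using assms(2,3)
proof (induction "card A" arbitrary: A e rule: less_induct)
  case less
  have tree: "tree_graph V E" and conn: "connected_graph V E" and fin: "finite_graph V E"
    using bt by (auto simp: boundary_tree_def tree_graph_def connected_graph_def)
  have "e \<in> cut E A"
    using less.prems(2) by simp
  then obtain a b where e: "e = {a, b}" and ab: "a \<in> A" "b \<notin> A" "a \<in> V" "{a, b} \<in> E"
    by (rule in_cutE[OF fin])
  show ?case
  proof (cases "a \<in> M")
    case True
    then show ?thesis
      using ab by blast
  next
    case False
    then have "card {g \<in> E. a \<in> g} \<noteq> 1"
      using bt ab by (auto simp: boundary_tree_def degree_def)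
    then have "{g \<in> E. a \<in> g} \<noteq> {e}"
      by force
    then obtain f where f: "f \<in> E" "a \<in> f" "f \<noteq> e"
      using ab e by blast
    then obtain c where c: "f = {a, c}" "a \<noteq> c"
      using finite_graphE[OF fin f(1)] by (metis insert_commute insert_iff singletonD)
    have "f \<notin> cut E A"
      using f less.prems(2) by simp
    then have "c \<in> A"
      using c f ab by simp
    obtain C0 where C0: "C0 \<subseteq> V" "cut E C0 = {f}"
      using tree_graph_bridge[OF tree f(1)] .
    define C where "C = (if a \<in> C0 then V - C0 else C0)"
    have C: "C \<subseteq> V" "cut E C = {f}" "a \<notin> C"
      using C0 cut_compl[OF fin, of C0] by (auto simp: C_def)
    have "f \<in> cut E C"
      using C(2) by simp
    then have "c \<in> C"
      using c C(3) by simp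
    have "g \<notin> cut E (C - A)" for g
    proof
      assume "g \<in> cut E (C - A)"
      then obtain x y where xy: "g = {x, y}" "x \<in> C - A" "y \<notin> C - A" "{x, y} \<in> E"
        by (rule in_cutE[OF fin])
      show False
      proof (cases "y \<in> C")
        case True
        then have "g \<in> cut E A"
          using xy by simp
        then have "{x, y} = {a, b}"
          using xy less.prems(2) e by simp
        then show False
          using xy ab True C(3) by (auto simp: doubleton_eq_iff)
      next
        case False
        then have "g \<in> cut E C"
          using xy by simp
        then have "{x, y} = {a, c}"
          using xy C(2) c by simp
        then show False
          using xy C(3) \<open>c \<in> A\<close> by (auto simp: doubleton_eq_iff)
      qed
    qed
    then have "C - A = {}"
      using connected_cut_nonempty[OF conn, of "C - A"] C ab(3) by blast
    then have "C \<subset> A"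
      using C(3) ab(1) by blast
    then have "card C < card A"
      using less.prems(1) fin by (metis finite_graph_def finite_subset psubset_card_mono)
    then have "M \<inter> C \<noteq> {}"
      using less.hyps C by blast
    then show ?thesis
      using \<open>C \<subset> A\<close> by blast
  qed
qed

text \<open>
  Sides of edges that avoid a common vertex \<open>r\<close> are nested or disjoint. Otherwise \<open>A \<inter> B\<close>,
  \<open>A - B\<close>, \<open>B - A\<close> and the complement of \<open>A \<union> B\<close> are four nonempty sets which only the two edges
  \<open>e\<close> and \<open>f\<close> could connect with each other, and in each case one of the four has no boundary.
\<close>

lemma cuts_laminar:
  assumes conn: "connected_graph V E"
    and A: "A \<subseteq> V" "cut E A = {e}" and B: "B \<subseteq> V" "cut E B = {f}"
    and r: "r \<in> V" "r \<notin> A" "r \<notin> B"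
  shows "A \<inter> B = {} \<or> A \<subseteq> B \<or> B \<subseteq> A"
proof (rule ccontr)
  assume "\<not> ?thesis"
  then have ne: "A \<inter> B \<noteq> {}" "A - B \<noteq> {}" "B - A \<noteq> {}"
    by auto
  have fin: "finite_graph V E"
    using conn by (simp add: connected_graph_def)
  have "e \<in> cut E A" "f \<in> cut E B"
    using A B by simp_all
  obtain x y where e: "e = {x, y}" and xy: "x \<in> A" "y \<notin> A" "{x, y} \<in> E"
    using \<open>e \<in> cut E A\<close> by (rule in_cutE[OF fin])
  obtain u v where f: "f = {u, v}" and uv: "u \<in> B" "v \<notin> B" "{u, v} \<in> E"
    using \<open>f \<in> cut E B\<close> by (rule in_cutE[OF fin])
  have contra: False
    if S: "S \<subseteq> V" "S \<noteq> {}" "S \<noteq> V" "cut E S \<subseteq> cut E A \<union> cut E B" "e \<notin> cut E S" "f \<notin> cut E S" for S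
    using connected_cut_nonempty[OF conn S(1-3)] S(4-6) unfolding A B by blast
  show False
  proof (cases "e = f")
    case True
    have "e \<in> cut E B"
      using True B(2) by simp
    then have "(x \<in> B) \<noteq> (y \<in> B)"
      unfolding e by simp
    then have "e \<notin> cut E ((A - B) \<union> (B - A))"
      using xy e by auto
    moreover have "cut E ((A - B) \<union> (B - A)) \<subseteq> cut E A \<union> cut E B"
      by (auto simp: cut_def)
    ultimately show False
      using contra[of "(A - B) \<union> (B - A)"] True A(1) B(1) ne r by blast
  next
    case False
    have "e \<notin> cut E B" "f \<notin> cut E A"
      using False A(2) B(2) by auto
    then have same: "(x \<in> B) = (y \<in> B)" "(u \<in> A) = (v \<in> A)"
      unfolding e f using xy uv by simp_all
    have V: "e \<subseteq> V" "f \<subseteq> V"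
      using fin xy(3) uv(3) e f by (auto simp: finite_graph_def)
    consider "x \<in> B" "u \<in> A" | "x \<in> B" "u \<notin> A" | "x \<notin> B" "u \<in> A" | "x \<notin> B" "u \<notin> A"
      by blast
    then show False
    proof cases
      case 1
      have "cut E (A \<union> B) \<subseteq> cut E A \<union> cut E B" "e \<notin> cut E (A \<union> B)" "f \<notin> cut E (A \<union> B)"
        using 1 same xy uv e f by (auto simp: cut_def)
      then show False
        using contra[of "A \<union> B"] A(1) B(1) ne r by blast
    next
      case 2
      have "cut E (A - B) \<subseteq> cut E A \<union> cut E B" "e \<notin> cut E (A - B)" "f \<notin> cut E (A - B)"
        using 2 same xy uv e f by (auto simp: cut_def)
      then show False
        using contra[of "A - B"] A(1) B(1) ne r by blast
    next
      case 3
      have "cut E (B - A) \<subseteq> cut E A \<union> cut E B" "e \<notin> cut E (B - A)" "f \<notin> cut E (B - A)"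
        using 3 same xy uv e f by (auto simp: cut_def)
      then show False
        using contra[of "B - A"] A(1) B(1) ne r by blast
    next
      case 4
      have "cut E (A \<inter> B) \<subseteq> cut E A \<union> cut E B" "e \<notin> cut E (A \<inter> B)" "f \<notin> cut E (A \<inter> B)"
        using 4 same xy uv e f by (auto simp: cut_def)
      then show False
        using contra[of "A \<inter> B"] A(1) B(1) ne r by blast
    qed
  qed
qed

section \<open>Rooted binary trees as graphs\<close>

text \<open>
  Rooted trees in which every node is a leaf or has two children. The inner nodes carry labels, too,
  since they are to become vertices of a graph.
\<close>

datatype 'a btree = Leaf 'a | Node 'a "'a btree" "'a btree"

primrec root_label :: "'a btree \<Rightarrow> 'a" where
  "root_label (Leaf x) = x"
| "root_label (Node z a b) = z"

primrec labels :: "'a btree \<Rightarrow> 'a list" where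
  "labels (Leaf x) = [x]"
| "labels (Node z a b) = z # labels a @ labels b"

primrec leaves :: "'a btree \<Rightarrow> 'a list" where
  "leaves (Leaf x) = [x]"
| "leaves (Node z a b) = leaves a @ leaves b"

primrec subtrees :: "'a btree \<Rightarrow> 'a btree set" where
  "subtrees (Leaf x) = {Leaf x}"
| "subtrees (Node z a b) = insert (Node z a b) (subtrees a \<union> subtrees b)"

text \<open>
  The edges of the graph in which the root of the tree is joined to a further vertex \<open>r\<close>, its
  parent, and every other node to its parent. Thus each edge belongs to exactly one subtree, the
  one hanging below it.
\<close>

primrec edges :: "'a \<Rightarrow> 'a btree \<Rightarrow> 'a set set" where
  "edges r (Leaf x) = {{r, x}}"
| "edges r (Node z a b) = insert {r, z} (edges z a \<union> edges z b)"

lemma root_label_in_labels [simp]: "root_label t \<in> set (labels t)"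
  by (cases t) auto

lemma self_in_subtrees [simp]: "t \<in> subtrees t"
  by (cases t) auto

lemma leaves_nonempty [simp]: "leaves t \<noteq> []"
  by (induction t) auto

lemma leaves_subset_labels: "set (leaves t) \<subseteq> set (labels t)"
  by (induction t) auto

lemma distinct_leaves: "distinct (labels t) \<Longrightarrow> distinct (leaves t)"
proof (induction t)
  case (Node z a b)
  then show ?case
    using leaves_subset_labels[of a] leaves_subset_labels[of b] by auto
qed simp

lemma labels_subtree: "s \<in> subtrees t \<Longrightarrow> set (labels s) \<subseteq> set (labels t)"
  by (induction t) auto

lemma leaves_subtree: "s \<in> subtrees t \<Longrightarrow> \<exists>u v. leaves t = u @ leaves s @ v"
proof (induction t)
  case (Node z a b)
  consider "s = Node z a b" | "s \<in> subtrees a" | "s \<in> subtrees b"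
    using Node.prems by auto
  then show ?case
  proof cases
    case 1
    then show ?thesis
      by (intro exI[of _ "[]"]) simp
  next
    case 2
    then obtain u v where "leaves a = u @ leaves s @ v"
      using Node.IH(1) by blast
    then have "leaves (Node z a b) = u @ leaves s @ (v @ leaves b)"
      by simp
    then show ?thesis
      by blast
  next
    case 3
    then obtain u v where "leaves b = u @ leaves s @ v"
      using Node.IH(2) by blast
    then have "leaves (Node z a b) = (leaves a @ u) @ leaves s @ v"
      by simp
    then show ?thesis
      by blast
  qed
qed (auto intro: exI[of _ "[]"])

lemma leaves_inter_labels_subtree:
  "distinct (labels t) \<Longrightarrow> s \<in> subtrees t \<Longrightarrow> set (leaves t) \<inter> set (labels s) = set (leaves s)"
proof (induction t)
  case (Node z a b)
  consider "s = Node z a b" | "s \<in> subtrees a" | "s \<in> subtrees b"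
    using Node.prems by auto
  then show ?case
  proof cases
    case 1
    then show ?thesis
      using leaves_subset_labels[of s] by auto
  next
    case 2
    then show ?thesis
      using Node labels_subtree[OF 2] leaves_subset_labels[of b] by auto
  next
    case 3
    then show ?thesis
      using Node labels_subtree[OF 3] leaves_subset_labels[of a] by auto
  qed
qed auto

lemma edges_subset: "e \<in> edges r t \<Longrightarrow> e \<subseteq> insert r (set (labels t))"
  by (induction t arbitrary: r) fastforce+

lemma finite_graph_edges:
  assumes "distinct (labels t)" "r \<notin> set (labels t)"
  shows "finite_graph (insert r (set (labels t))) (edges r t)"
proof -
  have "card e = 2" if "e \<in> edges r t" for e
    using that assms by (induction t arbitrary: r) (auto simp: card_2_iff)
  then show ?thesis
    using edges_subset by (fastforce simp: finite_graph_def)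
qed

lemma cut_edges_disjoint: "S \<inter> insert r (set (labels t)) = {} \<Longrightarrow> cut (edges r t) S = {}"
  using edges_subset[of _ r t] unfolding cut_def by blast

lemma cut_edges_superset: "insert r (set (labels t)) \<subseteq> S \<Longrightarrow> cut (edges r t) S = {}"
  using edges_subset[of _ r t] unfolding cut_def by blast

lemma cut_insert:
  "cut (insert e E) S = (if e \<inter> S \<noteq> {} \<and> \<not> e \<subseteq> S then {e} else {}) \<union> cut E S"
  by (auto simp: cut_def)

lemma cut_labels:
  assumes "r \<notin> set (labels t)"
  shows "cut (edges r t) (set (labels t)) = {{r, root_label t}}"
proof (cases t)
  case (Leaf x)
  then show ?thesis
    using assms by (auto simp: cut_def)
next
  case (Node z a b)
  then have "cut (edges z a) (set (labels t)) = {}" "cut (edges z b) (set (labels t)) = {}"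
    by (auto intro!: cut_edges_superset)
  then show ?thesis
    using Node assms by (simp add: cut_insert cut_Un)
qed

lemma cut_labels_below:
  assumes "distinct (labels (Node z a b))" "r \<notin> set (labels (Node z a b))"
  shows "s \<in> subtrees a \<Longrightarrow>
      cut (edges r (Node z a b)) (set (labels s)) = cut (edges z a) (set (labels s))"
    and "s \<in> subtrees b \<Longrightarrow>
      cut (edges r (Node z a b)) (set (labels s)) = cut (edges z b) (set (labels s))"
proof -
  assume s: "s \<in> subtrees a"
  then have "cut (edges z b) (set (labels s)) = {}" "{r, z} \<inter> set (labels s) = {}"
    using labels_subtree[OF s] assms by (auto intro!: cut_edges_disjoint)
  then show "cut (edges r (Node z a b)) (set (labels s)) = cut (edges z a) (set (labels s))"
    by (simp add: cut_insert cut_Un)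
next
  assume s: "s \<in> subtrees b"
  then have "cut (edges z a) (set (labels s)) = {}" "{r, z} \<inter> set (labels s) = {}"
    using labels_subtree[OF s] assms by (auto intro!: cut_edges_disjoint)
  then show "cut (edges r (Node z a b)) (set (labels s)) = cut (edges z b) (set (labels s))"
    by (simp add: cut_insert cut_Un)
qed

text \<open>
  The sides avoiding \<open>r\<close> of the edges are precisely the label sets of the subtrees: this is the
  content of the next two lemmas.
\<close>

lemma edge_above_subtree:
  assumes "distinct (labels t)" "r \<notin> set (labels t)" "s \<in> subtrees t"
  shows "\<exists>e\<in>edges r t. cut (edges r t) (set (labels s)) = {e}"
proof -
  have "\<exists>e. cut (edges r t) (set (labels s)) = {e}"
    using assms
  proof (induction t arbitrary: r)
    case (Leaf x)
    then show ?case
      using cut_labels[of r "Leaf x"] by auto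
  next
    case (Node z a b)
    consider "s = Node z a b" | "s \<in> subtrees a" | "s \<in> subtrees b"
      using Node.prems by auto
    then show ?case
    proof cases
      case 1
      then show ?thesis
        using cut_labels[OF Node.prems(2)] by metis
    next
      case 2
      then show ?thesis
        using cut_labels_below(1)[OF Node.prems(1,2)] Node.IH(1)[of z] Node.prems by simp
    next
      case 3
      then show ?thesis
        using cut_labels_below(2)[OF Node.prems(1,2)] Node.IH(2)[of z] Node.prems by simp
    qed
  qed
  then show ?thesis
    by (auto simp: cut_def)
qed

lemma subtree_below_edge:
  assumes "distinct (labels t)" "r \<notin> set (labels t)" "e \<in> edges r t"
  shows "\<exists>s\<in>subtrees t. cut (edges r t) (set (labels s)) = {e}"
  using assms
proof (induction t arbitrary: r)
  case (Leaf x)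
  then show ?case
    using cut_labels[of r "Leaf x"] by auto
next
  case (Node z a b)
  consider "e = {r, z}" | "e \<in> edges z a" | "e \<in> edges z b"
    using Node.prems by auto
  then show ?case
  proof cases
    case 1
    then show ?thesis
      using cut_labels[OF Node.prems(2)] by (metis root_label.simps(2) self_in_subtrees)
  next
    case 2
    then obtain s where "s \<in> subtrees a" "cut (edges z a) (set (labels s)) = {e}"
      using Node.IH(1)[of z] Node.prems by auto
    then show ?thesis
      using cut_labels_below(1)[OF Node.prems(1,2)] by (intro bexI[of _ s]) auto
  next
    case 3
    then obtain s where "s \<in> subtrees b" "cut (edges z b) (set (labels s)) = {e}"
      using Node.IH(2)[of z] Node.prems by auto
    then show ?thesis
      using cut_labels_below(2)[OF Node.prems(1,2)] by (intro bexI[of _ s]) auto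
  qed
qed

text \<open>
  Connectedness: a vertex set without boundary that contains \<open>r\<close> contains all labels, and one that
  does not contain \<open>r\<close> contains none of them.
\<close>

lemma cut_edges_empty_same_side:
  "cut (edges r t) S = {} \<Longrightarrow> v \<in> set (labels t) \<Longrightarrow> (v \<in> S) = (r \<in> S)"
proof (induction t arbitrary: r)
  case (Leaf x)
  then have "{r, x} \<notin> cut (edges r (Leaf x)) S"
    by simp
  then show ?case
    using Leaf.prems(2) by auto
next
  case (Node z a b)
  then have "{r, z} \<notin> cut (edges r (Node z a b)) S"
    by simp
  moreover have "cut (edges z a) S = {}" "cut (edges z b) S = {}"
    using Node.prems(1) by (auto simp: cut_def)
  ultimately show ?case
    using Node.IH[of z] Node.prems(2) by auto
qed

lemma tree_graph_edges:
  assumes "distinct (labels t)" "r \<notin> set (labels t)"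
  shows "tree_graph (insert r (set (labels t))) (edges r t)"
proof (rule tree_graphI_bridges)
  show "connected_graph (insert r (set (labels t))) (edges r t)"
    unfolding connected_graph_iff_cut
    using finite_graph_edges[OF assms] cut_edges_empty_same_side[of r t] by blast
qed (use subtree_below_edge[OF assms] in blast)

lemma edges_at_parent:
  assumes "distinct (labels t)" "r \<notin> set (labels t)"
  shows "{e \<in> edges r t. r \<in> e} = {{r, root_label t}}"
proof -
  have "{e \<in> edges r t. r \<in> e} = cut (edges r t) {r}"
    using cut_singleton[OF finite_graph_edges[OF assms]] by simp
  also have "\<dots> = cut (edges r t) (insert r (set (labels t)) - {r})"
    by (rule cut_compl[OF finite_graph_edges[OF assms], symmetric])
  also have "insert r (set (labels t)) - {r} = set (labels t)"
    using assms(2) by auto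
  finally show ?thesis
    using cut_labels[OF assms(2)] by simp
qed

lemma degree_edges:
  assumes "distinct (labels t)" "r \<notin> set (labels t)" "v \<in> set (labels t)"
  shows "degree (edges r t) v = (if v \<in> set (leaves t) then 1 else 3)"
  using assms
proof (induction t arbitrary: r)
  case (Leaf x)
  have "{e. e = {r, x} \<and> x \<in> e} = {{r, x}}"
    by auto
  then show ?case
    using Leaf by (simp add: degree_def)
next
  case (Node z a b)
  have d: "distinct (labels a)" "distinct (labels b)" "z \<notin> set (labels a)" "z \<notin> set (labels b)"
      "r \<noteq> z" "r \<notin> set (labels a)" "r \<notin> set (labels b)" "set (labels a) \<inter> set (labels b) = {}"
    using Node.prems by auto
  consider "v = z" | "v \<in> set (labels a)" | "v \<in> set (labels b)"
    using Node.prems by auto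
  then show ?case
  proof cases
    case 1
    have "{e \<in> edges r (Node z a b). z \<in> e} =
        {{r, z}} \<union> {e \<in> edges z a. z \<in> e} \<union> {e \<in> edges z b. z \<in> e}"
      by auto
    also have "\<dots> = {{r, z}, {z, root_label a}, {z, root_label b}}"
      unfolding edges_at_parent[OF d(1,3)] edges_at_parent[OF d(2,4)] by blast
    also have "card \<dots> = 3"
    proof -
      have "root_label a \<noteq> root_label b" "r \<noteq> root_label a" "r \<noteq> root_label b"
        using d root_label_in_labels[of a] root_label_in_labels[of b] by (metis IntI empty_iff)+
      then show ?thesis
        using d by (simp add: doubleton_eq_iff)
    qed
    finally show ?thesis
      using 1 d leaves_subset_labels[of a] leaves_subset_labels[of b] by (auto simp: degree_def)
  next
    case 2
    then have "{e \<in> edges r (Node z a b). v \<in> e} = {e \<in> edges z a. v \<in> e}"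
      using d edges_subset[of _ z b] by auto
    then show ?thesis
      using 2 Node.IH(1)[OF d(1,3) 2] d leaves_subset_labels[of b] by (auto simp: degree_def)
  next
    case 3
    then have "{e \<in> edges r (Node z a b). v \<in> e} = {e \<in> edges z b. v \<in> e}"
      using d edges_subset[of _ z a] by auto
    then show ?thesis
      using 3 Node.IH(2)[OF d(2,4) 3] d leaves_subset_labels[of a] by (auto simp: degree_def)
  qed
qed

lemma binary_tree_edges:
  assumes "distinct (labels t)" "r \<notin> set (labels t)"
  shows "binary_tree (insert r (set (leaves t))) (insert r (set (labels t))) (edges r t)"
proof -
  have "degree (edges r t) r = 1"
    using edges_at_parent[OF assms] by (simp add: degree_def)
  then show ?thesis
    unfolding binary_tree_def
    using tree_graph_edges[OF assms] degree_edges[OF assms] leaves_subset_labels[of t]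
    by auto
qed

lemma edge_parts_subtree:
  assumes "distinct (labels t)" "r \<notin> set (labels t)" "s \<in> subtrees t"
    and "cut (edges r t) (set (labels s)) = {e}"
  shows "edge_parts (insert r (set (leaves t))) (insert r (set (labels t))) (edges r t) e =
    {set (leaves s), insert r (set (leaves t)) - set (leaves s)}"
proof -
  let ?M = "insert r (set (leaves t))"
  have "connected_graph (insert r (set (labels t))) (edges r t)"
    using tree_graph_edges[OF assms(1,2)] by (simp add: tree_graph_def)
  then have "edge_parts ?M (insert r (set (labels t))) (edges r t) e =
      {?M \<inter> set (labels s), ?M - set (labels s)}"
    by (rule edge_parts_bridge) (use labels_subtree[OF assms(3)] leaves_subset_labels[of t] assms(4) in auto)
  moreover have "?M \<inter> set (labels s) = set (leaves s)"
    using leaves_inter_labels_subtree[OF assms(1,3)] labels_subtree[OF assms(3)] assms(2) by auto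
  ultimately show ?thesis
    by (metis Diff_Int_distrib2 Diff_Int2 Int_commute Diff_Int inf.idem Diff_cancel Un_empty_left)
qed

section \<open>Tours and laminar families\<close>

text \<open>
  A list of distinct points, closed up to a cycle.
\<close>

lemma cyclic_order_of_list:
  assumes "distinct xs" "xs \<noteq> []"
  obtains \<pi> where "cyclic_order (set xs) \<pi>"
    "\<And>i. i < length xs \<Longrightarrow> \<pi> (xs ! i) = xs ! (Suc i mod length xs)"
proof -
  let ?\<pi> = "cycle_of_list xs"
  have pow: "(?\<pi> ^^ n) (xs ! i) = xs ! ((n + i) mod length xs)" if "i < length xs" for n i
  proof -
    have "map (?\<pi> ^^ n) xs ! i = rotate n xs ! i"
      using cyclic_rotation[OF assms(1)] by metis
    then show ?thesis
      using that by (simp add: nth_rotate)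
  qed
  have perm: "?\<pi> permutes set xs"
    by (rule cycle_permutes)
  have "set xs \<subseteq> orbit ?\<pi> (xs ! 0)"
  proof
    fix x assume "x \<in> set xs"
    then obtain i where i: "i < length xs" "x = xs ! i"
      by (metis in_set_conv_nth)
    then have "x = (?\<pi> ^^ (i + length xs)) (xs ! 0)"
      using pow[of 0 "i + length xs"] assms(2) by simp
    then show "x \<in> orbit ?\<pi> (xs ! 0)"
      using assms(2) by (auto simp: orbit_altdef)
  qed
  moreover have "orbit ?\<pi> (xs ! 0) \<subseteq> set xs"
    using permutes_orbit_subset[OF perm, of "xs ! 0"] assms(2) by simp
  ultimately have "cyclic_order (set xs) ?\<pi>"
    using perm assms(2) unfolding cyclic_order_def cyclic_on_def by (metis length_greater_0_conv nth_mem subset_antisym)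
  then show ?thesis
    using that[of ?\<pi>] pow[of _ 1] by simp
qed

text \<open>
  A segment of the list that does not begin at its head is left only at its last element, and its
  complement only at the element preceding the segment.
\<close>

lemma segment_unique_exit:
  assumes d: "distinct xs" and xs: "xs = u @ c @ v" and ne: "u \<noteq> []" "c \<noteq> []"
    and \<pi>: "\<And>i. i < length xs \<Longrightarrow> \<pi> (xs ! i) = xs ! (Suc i mod length xs)"
  shows "\<exists>!p. p \<in> set c \<and> \<pi> p \<notin> set c"
    and "\<exists>!p. p \<in> set xs - set c \<and> \<pi> p \<notin> set xs - set c"
proof -
  let ?n = "length xs" and ?a = "length u" and ?b = "length u + length c"
  have bounds: "0 < ?a" "?a < ?b" "?b \<le> ?n"
    using ne xs by auto
  have in_c: "xs ! i \<in> set c \<longleftrightarrow> ?a \<le> i \<and> i < ?b" if i: "i < ?n" for i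
  proof
    assume "xs ! i \<in> set c"
    then obtain j where j: "j < length c" "xs ! i = c ! j"
      by (metis in_set_conv_nth)
    then have "xs ! i = xs ! (?a + j)"
      using xs by (simp add: nth_append)
    then have "i = ?a + j"
      using d i j bounds by (simp add: nth_eq_iff_index_eq)
    then show "?a \<le> i \<and> i < ?b"
      using j by simp
  next
    assume "?a \<le> i \<and> i < ?b"
    then show "xs ! i \<in> set c"
      using xs by (auto simp: nth_append)
  qed
  have in_xs: "p \<in> set xs \<longleftrightarrow> (\<exists>i<?n. p = xs ! i)" for p
    by (metis in_set_conv_nth)
  have succ: "Suc i mod ?n = (if Suc i = ?n then 0 else Suc i)" if "i < ?n" for i
    using that by auto
  have exit: "\<pi> (xs ! i) \<in> set c \<longleftrightarrow> ?a \<le> Suc i \<and> Suc i < ?b" "\<pi> (xs ! i) \<in> set xs" if "i < ?n" for i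
  proof -
    have "Suc i mod ?n < ?n"
      using that by (intro mod_less_divisor) linarith
    then show "\<pi> (xs ! i) \<in> set c \<longleftrightarrow> ?a \<le> Suc i \<and> Suc i < ?b" "\<pi> (xs ! i) \<in> set xs"
      using \<pi>[OF that] in_c[of "Suc i mod ?n"] succ[OF that] bounds by (auto split: if_splits)
  qed
  show "\<exists>!p. p \<in> set c \<and> \<pi> p \<notin> set c"
  proof (rule ex1I[of _ "xs ! (?b - 1)"])
    show "xs ! (?b - 1) \<in> set c \<and> \<pi> (xs ! (?b - 1)) \<notin> set c"
    proof -
      have "?b - 1 < ?n" "?a \<le> ?b - 1" "?b - 1 < ?b" "\<not> Suc (?b - 1) < ?b"
        using bounds by linarith+
      then show ?thesis
        using in_c[of "?b - 1"] exit(1)[of "?b - 1"] by blast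
    qed
    fix p assume p: "p \<in> set c \<and> \<pi> p \<notin> set c"
    then have "p \<in> set xs"
      using xs by auto
    then obtain i where "i < ?n" "p = xs ! i"
      using in_xs by blast
    moreover from this have "i = ?b - 1"
      using p in_c[of i] exit(1)[of i] by auto
    ultimately show "p = xs ! (?b - 1)"
      by simp
  qed
  show "\<exists>!p. p \<in> set xs - set c \<and> \<pi> p \<notin> set xs - set c"
  proof (rule ex1I[of _ "xs ! (?a - 1)"])
    show "xs ! (?a - 1) \<in> set xs - set c \<and> \<pi> (xs ! (?a - 1)) \<notin> set xs - set c"
    proof -
      have "?a - 1 < ?n" "\<not> ?a \<le> ?a - 1" "?a \<le> Suc (?a - 1)" "Suc (?a - 1) < ?b"
        using bounds by linarith+
      then show ?thesis
        using in_c[of "?a - 1"] exit[of "?a - 1"] in_xs[of "xs ! (?a - 1)"] by blast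
    qed
    fix p assume p: "p \<in> set xs - set c \<and> \<pi> p \<notin> set xs - set c"
    then obtain i where "i < ?n" "p = xs ! i"
      using in_xs by blast
    moreover from this have "i = ?a - 1"
      using p in_c[of i] exit[of i] by auto
    ultimately show "p = xs ! (?a - 1)"
      by simp
  qed
qed

text \<open>
  The leaves in their order from left to right, preceded by \<open>r\<close>, form a tour, because the leaves of
  each subtree are a segment of that list.
\<close>

lemma tours_edges_nonempty:
  assumes "distinct (labels t)" "r \<notin> set (labels t)"
  shows "tours (insert r (set (leaves t))) (insert r (set (labels t))) (edges r t) \<noteq> {}"
proof -
  let ?xs = "r # leaves t"
  have d: "distinct ?xs"
    using distinct_leaves[OF assms(1)] leaves_subset_labels[of t] assms(2) by auto
  obtain \<pi> where \<pi>: "cyclic_order (set ?xs) \<pi>"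
      "\<And>i. i < length ?xs \<Longrightarrow> \<pi> (?xs ! i) = ?xs ! (Suc i mod length ?xs)"
    using cyclic_order_of_list[OF d] by blast
  have "\<exists>!p. p \<in> A \<and> \<pi> p \<notin> A"
    if e: "e \<in> edges r t"
      and A: "A \<in> edge_parts (set ?xs) (insert r (set (labels t))) (edges r t) e" for e A
  proof -
    obtain s where s: "s \<in> subtrees t" "cut (edges r t) (set (labels s)) = {e}"
      using subtree_below_edge[OF assms e] by blast
    obtain u v where uv: "leaves t = u @ leaves s @ v"
      using leaves_subtree[OF s(1)] by blast
    have "?xs = (r # u) @ leaves s @ v"
      using uv by simp
    note exits = segment_unique_exit[OF d this _ _ \<pi>(2)]
    have "A = set (leaves s) \<or> A = set ?xs - set (leaves s)"
      using A edge_parts_subtree[OF assms s] by simp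
    then show ?thesis
      using exits by (elim disjE) simp_all
  qed
  then have "\<pi> \<in> tours (set ?xs) (insert r (set (labels t))) (edges r t)"
    using \<pi>(1) unfolding tours_def by blast
  then show ?thesis
    by auto
qed

text \<open>
  Every laminar family of subsets of \<open>X\<close> consists of leaf sets of subtrees of a single tree with
  leaf set \<open>X\<close>. The set \<open>X\<close> is split into a set \<open>C\<close> and its complement in such a way that every
  other member of the family lies on one side of the splitting. The set \<open>Z\<close> collects the points
  that the labels of inner nodes have to avoid.
\<close>

lemma laminar_binary_tree:
  assumes inf: "infinite (UNIV :: 'a set)"
  shows "finite X \<Longrightarrow> X \<noteq> {} \<Longrightarrow> finite Z \<Longrightarrow> X \<subseteq> Z \<Longrightarrow>
    (\<And>C. C \<in> F \<Longrightarrow> C \<noteq> {} \<and> C \<subseteq> X) \<Longrightarrow>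
    (\<And>C D. C \<in> F \<Longrightarrow> D \<in> F \<Longrightarrow> C \<inter> D = {} \<or> C \<subseteq> D \<or> D \<subseteq> C) \<Longrightarrow>
    \<exists>t :: 'a btree. set (leaves t) = X \<and> distinct (labels t) \<and> set (labels t) \<inter> Z = X \<and>
      (\<forall>C\<in>F. \<exists>s\<in>subtrees t. set (leaves s) = C)"
proof (induction X arbitrary: Z F rule: finite_psubset_induct)
  case (psubset X)
  show ?case
  proof (cases "\<exists>x. X = {x}")
    case True
    then obtain x where x: "X = {x}" ..
    then have "\<forall>C\<in>F. \<exists>s\<in>subtrees (Leaf x). set (leaves s) = C"
      using psubset.prems(4) by auto
    then show ?thesis
      using x psubset.prems(3) by (intro exI[of _ "Leaf x"]) auto
  next
    case False
    \<comment> \<open>A maximal proper member of the family if there is one, and any singleton otherwise.\<close>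
    obtain C where C: "C \<subset> X" "C \<noteq> {}" "\<And>D. D \<in> F \<Longrightarrow> D = X \<or> D \<subseteq> C \<or> D \<subseteq> X - C"
    proof (cases "F - {X} = {}")
      case True
      obtain x where "x \<in> X"
        using psubset.prems(1) by blast
      then show ?thesis
        using that[of "{x}"] False True by blast
    next
      case False
      have "F - {X} \<subseteq> Pow X"
        using psubset.prems(4) by blast
      moreover have "finite (Pow X)"
        using psubset.hyps(1) by simp
      ultimately have "finite (F - {X})"
        by (rule finite_subset)
      from finite_has_maximal[OF this False]
      obtain C where C: "C \<in> F - {X}" and max: "\<forall>D\<in>F - {X}. C \<subseteq> D \<longrightarrow> C = D"
        by blast
      show ?thesis
      proof (rule that[of C])
        show "C \<subset> X" "C \<noteq> {}"
          using psubset.prems(4)[of C] C by auto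
        fix D assume "D \<in> F"
        then show "D = X \<or> D \<subseteq> C \<or> D \<subseteq> X - C"
          using psubset.prems(4)[of D] psubset.prems(5)[of C D] C max by blast
      qed
    qed
    have "finite C"
      using C(1) psubset.hyps finite_subset by blast
    let ?F1 = "{D \<in> F. D \<subseteq> C}" and ?F2 = "{D \<in> F. D \<subseteq> X - C}"
    have "\<exists>t. set (leaves t) = C \<and> distinct (labels t) \<and> set (labels t) \<inter> Z = C \<and>
        (\<forall>D\<in>?F1. \<exists>s\<in>subtrees t. set (leaves s) = D)"
    proof (rule psubset.IH[OF C(1,2) psubset.prems(2)])
      show "C \<subseteq> Z"
        using C(1) psubset.prems(3) by blast
    qed (use psubset.prems(4,5) in blast)+
    then obtain a where a: "set (leaves a) = C" "distinct (labels a)" "set (labels a) \<inter> Z = C"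
        "\<forall>D\<in>?F1. \<exists>s\<in>subtrees a. set (leaves s) = D"
      by blast
    have "\<exists>t. set (leaves t) = X - C \<and> distinct (labels t) \<and>
        set (labels t) \<inter> (Z \<union> set (labels a)) = X - C \<and>
        (\<forall>D\<in>?F2. \<exists>s\<in>subtrees t. set (leaves s) = D)"
    proof (rule psubset.IH)
      show "X - C \<subset> X" "X - C \<noteq> {}" "X - C \<subseteq> Z \<union> set (labels a)" "finite (Z \<union> set (labels a))"
        using C(1,2) psubset.prems(2,3) by auto
    qed (use psubset.prems(4,5) in blast)+
    then obtain b where b: "set (leaves b) = X - C" "distinct (labels b)"
        "set (labels b) \<inter> (Z \<union> set (labels a)) = X - C"
        "\<forall>D\<in>?F2. \<exists>s\<in>subtrees b. set (leaves s) = D"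
      by blast
    have "finite (Z \<union> set (labels a) \<union> set (labels b))"
      using psubset.prems(2) by simp
    from ex_new_if_finite[OF inf this]
    obtain z where z: "z \<notin> Z \<union> set (labels a) \<union> set (labels b)" ..
    have "set (labels a) \<inter> set (labels b) = {}"
      using a(3) b(3) psubset.prems(3) by blast
    then have "distinct (labels (Node z a b))"
      using a(2) b(2) z by simp
    moreover have "set (labels (Node z a b)) \<inter> Z = X"
      using a(3) b(3) z C(1) psubset.prems(3) by auto
    moreover have "set (leaves (Node z a b)) = X"
      using a(1) b(1) C(1) by auto
    moreover have "\<exists>s\<in>subtrees (Node z a b). set (leaves s) = D" if D: "D \<in> F" for D
    proof -
      consider "D = X" | "D \<in> ?F1" | "D \<in> ?F2"
        using C(3)[OF D] D by blast
      then show ?thesis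
      proof cases
        case 1
        then show ?thesis
          using \<open>set (leaves (Node z a b)) = X\<close> self_in_subtrees by blast
      next
        case 2
        then show ?thesis
          using a(4) by (metis UnCI insertCI subtrees.simps(2))
      next
        case 3
        then show ?thesis
          using b(4) by (metis UnCI insertCI subtrees.simps(2))
      qed
    qed
    ultimately show ?thesis
      by blast
  qed
qed

lemma binary_tree_of_laminar:
  assumes inf: "infinite (UNIV :: 'a set)"
    and M: "finite (M :: 'a set)" "r \<in> M" "M \<noteq> {r}"
    and F: "\<And>C. C \<in> F \<Longrightarrow> C \<noteq> {} \<and> C \<subseteq> M - {r}"
    and laminar: "\<And>C D. C \<in> F \<Longrightarrow> D \<in> F \<Longrightarrow> C \<inter> D = {} \<or> C \<subseteq> D \<or> D \<subseteq> C"
  shows "\<exists>V E. binary_tree M V E \<and> tours M V E \<noteq> {} \<and>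
    (\<forall>C\<in>F. \<exists>e\<in>E. edge_parts M V E e = {C, M - C})"
proof -
  have "\<exists>t :: 'a btree. set (leaves t) = M - {r} \<and> distinct (labels t) \<and>
      set (labels t) \<inter> M = M - {r} \<and> (\<forall>C\<in>F. \<exists>s\<in>subtrees t. set (leaves s) = C)"
    by (rule laminar_binary_tree[OF inf]) (use M F laminar in auto)
  then obtain t :: "'a btree" where t: "set (leaves t) = M - {r}" "distinct (labels t)"
      "set (labels t) \<inter> M = M - {r}" and sub: "\<forall>C\<in>F. \<exists>s\<in>subtrees t. set (leaves s) = C"
    by blast
  have r: "r \<notin> set (labels t)"
    using t(3) M(2) by blast
  have M_eq: "insert r (set (leaves t)) = M"
    using t(1) M(2) by blast
  have "\<exists>e\<in>edges r t. edge_parts M (insert r (set (labels t))) (edges r t) e = {C, M - C}"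
    if C: "C \<in> F" for C
  proof -
    obtain s where s: "s \<in> subtrees t" "set (leaves s) = C"
      using sub C by blast
    obtain e where e: "e \<in> edges r t" "cut (edges r t) (set (labels s)) = {e}"
      using edge_above_subtree[OF t(2) r s(1)] by blast
    show ?thesis
      using edge_parts_subtree[OF t(2) r s(1) e(2)] e(1) s(2) unfolding M_eq by blast
  qed
  then show ?thesis
    using binary_tree_edges[OF t(2) r] tours_edges_nonempty[OF t(2) r] unfolding M_eq by blast
qed

section \<open>Binary refinements and fillings\<close>

lemma tours_boundary_tree:
  assumes "boundary_tree M V E"
  shows "tours M V E = tours_nontrivial M V E"
proof -
  have conn: "connected_graph V E" and fin: "finite_graph V E" and tree: "tree_graph V E" and M: "M \<subseteq> V"
    using assms by (auto simp: boundary_tree_def joins_def connected_graph_def)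
  have "{} \<notin> edge_parts M V E e" if e: "e \<in> E" for e
  proof -
    obtain A where A: "A \<subseteq> V" "cut E A = {e}"
      using tree_graph_bridge[OF tree e] .
    have "M \<inter> A \<noteq> {}" "M \<inter> (V - A) \<noteq> {}"
      using boundary_tree_meets_cut[OF assms, of _ e] A cut_compl[OF fin, of A] by auto
    then show ?thesis
      unfolding edge_parts_bridge[OF conn A M] by blast
  qed
  then show ?thesis
    unfolding tours_def tours_nontrivial_def by blast
qed

lemma binary_tree_boundary_tree: "binary_tree M V E \<Longrightarrow> boundary_tree M V E"
  unfolding binary_tree_def boundary_tree_def joins_def tree_graph_def by fastforce

text \<open>
  Every tree containing \<open>M\<close> is refined by a binary tree with boundary \<open>M\<close>: each nontrivial
  splitting of \<open>M\<close> by an edge of the former is also one by an edge of the latter. Planarity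
  depends on the splittings only, and so every tour of the binary tree is planar with respect to all
  edges of the given tree that split \<open>M\<close> nontrivially.
\<close>

lemma binary_refinement:
  fixes M V :: "'a set"
  assumes inf: "infinite (UNIV :: 'a set)" and M: "finite M" "2 \<le> card M"
    and tree: "tree_graph V E" and MV: "M \<subseteq> V"
  obtains V' E' where "binary_tree M V' E'" "tours M V' E' \<noteq> {}"
    "tours M V' E' \<subseteq> tours_nontrivial M V E"
proof -
  have conn: "connected_graph V E" and fin: "finite_graph V E"
    using tree by (auto simp: tree_graph_def connected_graph_def)
  have "M \<noteq> {}" "\<And>r. M \<noteq> {r}"
    using M by auto
  then obtain r where r: "r \<in> M" "M \<noteq> {r}"
    by blast
  \<comment> \<open>Each splitting is represented by its part that does not contain the fixed point \<open>r\<close>.\<close>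
  define F where "F = {M \<inter> A | A e. A \<subseteq> V \<and> cut E A = {e} \<and> r \<notin> A \<and> M \<inter> A \<noteq> {}}"
  have "\<exists>V' E'. binary_tree M V' E' \<and> tours M V' E' \<noteq> {} \<and>
      (\<forall>C\<in>F. \<exists>e\<in>E'. edge_parts M V' E' e = {C, M - C})"
  proof (rule binary_tree_of_laminar[OF inf M(1) r])
    show "C \<noteq> {} \<and> C \<subseteq> M - {r}" if "C \<in> F" for C
      using that unfolding F_def by blast
    show "C \<inter> D = {} \<or> C \<subseteq> D \<or> D \<subseteq> C" if CD: "C \<in> F" "D \<in> F" for C D
    proof -
      obtain A e where A: "C = M \<inter> A" "A \<subseteq> V" "cut E A = {e}" "r \<notin> A"
        using CD(1) unfolding F_def by blast
      obtain B f where B: "D = M \<inter> B" "B \<subseteq> V" "cut E B = {f}" "r \<notin> B"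
        using CD(2) unfolding F_def by blast
      have "A \<inter> B = {} \<or> A \<subseteq> B \<or> B \<subseteq> A"
        by (rule cuts_laminar[OF conn A(2,3) B(2,3) _ A(4) B(4)]) (use r MV in blast)
      then show ?thesis
        unfolding A(1) B(1) by blast
    qed
  qed
  then obtain V' E' where bin: "binary_tree M V' E'" "tours M V' E' \<noteq> {}"
      and parts: "\<forall>C\<in>F. \<exists>e\<in>E'. edge_parts M V' E' e = {C, M - C}"
    by blast
  have "\<exists>e'\<in>E'. edge_parts M V' E' e' = edge_parts M V E e"
    if e: "e \<in> E" "{} \<notin> edge_parts M V E e" for e
  proof -
    obtain A0 where A0: "A0 \<subseteq> V" "cut E A0 = {e}"
      using tree_graph_bridge[OF tree e(1)] .
    define A where "A = (if r \<in> A0 then V - A0 else A0)"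
    have A: "A \<subseteq> V" "cut E A = {e}" "r \<notin> A"
      using A0 cut_compl[OF fin, of A0] by (auto simp: A_def)
    have p: "edge_parts M V E e = {M \<inter> A, M - A}"
      by (rule edge_parts_bridge[OF conn A(1,2) MV])
    have "M \<inter> A \<noteq> {}"
      using e(2) unfolding p by auto
    then have "M \<inter> A \<in> F"
      using A unfolding F_def by blast
    moreover have "M - M \<inter> A = M - A"
      by blast
    ultimately show ?thesis
      using parts unfolding p by metis
  qed
  then have "tours M V' E' \<subseteq> tours_nontrivial M V E"
    unfolding tours_def tours_nontrivial_def by fastforce
  then show ?thesis
    using that bin by blast
qed

lemma finite_cyclic_orders: "finite M \<Longrightarrow> finite {\<pi>. cyclic_order M \<pi>}"
  by (rule finite_subset[OF _ finite_permutations]) (auto simp: cyclic_order_def)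

lemma tours_subset_cyclic_orders: "tours M V E \<subseteq> {\<pi>. cyclic_order M \<pi>}"
  by (auto simp: tours_def)

lemma finite_tours: "finite M \<Longrightarrow> finite (tours M V E)"
  by (rule finite_subset[OF tours_subset_cyclic_orders finite_cyclic_orders])

lemma max_tour_attained:
  assumes "finite M" "tours M V E \<noteq> {}"
  shows "max_tour_half_perimeter M \<rho> V E \<in> half_perimeter_wrt M \<rho> ` tours M V E"
  unfolding max_tour_half_perimeter_def using assms finite_tours by (intro Max_in) auto

lemma max_tour_le:
  assumes "finite M" "tours M V E \<noteq> {}" "\<And>\<pi>. \<pi> \<in> tours M V E \<Longrightarrow> half_perimeter_wrt M \<rho> \<pi> \<le> w"
  shows "max_tour_half_perimeter M \<rho> V E \<le> w"
  using max_tour_attained[OF assms(1,2), of \<rho>] assms(3) by auto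

lemma le_max_tour:
  assumes "finite M" "\<pi> \<in> tours M V E"
  shows "half_perimeter_wrt M \<rho> \<pi> \<le> max_tour_half_perimeter M \<rho> V E"
  unfolding max_tour_half_perimeter_def using assms finite_tours by (intro Max_ge) auto

lemma finite_paths_between:
  assumes "finite V"
  shows "finite (paths_between V E u v)"
proof -
  have "paths_between V E u v \<subseteq> {xs. set xs \<subseteq> V \<and> distinct xs}"
    by (auto simp: paths_between_def is_path_def)
  then show ?thesis
    using finite_subset_distinct[OF assms] finite_subset by blast
qed

lemma graph_dist_le_path_weight:
  assumes "finite V" "vs \<in> paths_between V E u v"
  shows "graph_dist V E \<omega> u v \<le> path_weight \<omega> vs"
  unfolding graph_dist_def using assms(2) finite_paths_between[OF assms(1)] by (intro Min_le) auto

text \<open>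
  The subgraph \<open>F\<close> is usually a spanning tree: since it has fewer paths, its distances are at least
  those of the whole graph, while its weight is at most that of the whole graph.
\<close>

lemma half_perimeter_le_filling:
  assumes fill: "filling M \<rho> V E \<omega>" and F: "F \<subseteq> E" "tree_graph V F"
    and \<pi>: "\<pi> \<in> tours_nontrivial M V F"
  shows "half_perimeter_wrt M \<rho> \<pi> \<le> graph_weight E \<omega>"
proof -
  have fin: "finite V" "finite E" and M: "M \<subseteq> V" and nonneg: "\<forall>e\<in>E. 0 \<le> \<omega> e"
    using fill finite_edges by (auto simp: filling_def joins_def connected_graph_def finite_graph_def)
  have "half_perimeter_wrt M \<rho> \<pi> \<le> graph_weight F \<omega>"
  proof (rule half_perimeter_le_weight[OF F(2) M _ _ \<pi>])
    show "\<forall>e\<in>F. 0 \<le> \<omega> e"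
      using nonneg F(1) by blast
    fix p q vs assume pq: "p \<in> M" "q \<in> M" and "vs \<in> paths_between V F p q"
    then have "vs \<in> paths_between V E p q"
      using paths_between_mono[OF _ F(1)] by blast
    then have "graph_dist V E \<omega> p q \<le> path_weight \<omega> vs"
      by (rule graph_dist_le_path_weight[OF fin(1)])
    then show "\<rho> p q \<le> path_weight \<omega> vs"
      using fill pq by (force simp: filling_def)
  qed
  also have "\<dots> \<le> graph_weight E \<omega>"
    unfolding graph_weight_def by (rule sum_mono2) (use fin F nonneg in auto)
  finally show ?thesis .
qed

text \<open>
  A sufficiently large constant weight gives a filling, because distinct points of \<open>M\<close> are at least
  one edge apart.
\<close>

lemma filling_exists:
  assumes conn: "connected_graph V E" and M: "M \<subseteq> V" and metric: "pseudo_metric_on M \<rho>"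
  shows "\<exists>\<omega>. filling M \<rho> V E \<omega>"
proof -
  have fin: "finite V" "finite M"
    using conn M finite_subset by (auto simp: connected_graph_def finite_graph_def)
  have pos: "0 \<le> \<rho> p q" if "p \<in> M" "q \<in> M" for p q
    using metric that by (simp add: pseudo_metric_on_def)
  define K where "K = (\<Sum>p\<in>M. \<Sum>q\<in>M. \<rho> p q)"
  have "0 \<le> K"
    unfolding K_def by (intro sum_nonneg pos)
  have K: "\<rho> p q \<le> K" if "p \<in> M" "q \<in> M" for p q
  proof -
    have "\<rho> p q \<le> (\<Sum>q\<in>M. \<rho> p q)"
      using that pos fin by (intro member_le_sum) auto
    also have "\<dots> \<le> K"
      unfolding K_def using that pos fin by (intro member_le_sum[of p M "\<lambda>p. \<Sum>q\<in>M. \<rho> p q"] sum_nonneg) auto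
    finally show ?thesis .
  qed
  have "\<rho> p q \<le> path_weight (\<lambda>_. K) vs"
    if pq: "p \<in> M" "q \<in> M" and vs: "vs \<in> paths_between V E p q" for p q vs
  proof (cases "p = q")
    case True
    then have "\<rho> p q = 0"
      using metric pq by (simp add: pseudo_metric_on_def)
    then show ?thesis
      using \<open>0 \<le> K\<close> by (simp add: path_weight_def)
  next
    case False
    have "vs \<noteq> []" "hd vs = p" "last vs = q"
      using vs by (auto simp: paths_between_def is_path_def)
    then have "2 \<le> length vs"
      using False by (cases vs rule: remdups_adj.cases) auto
    then have "1 * K \<le> real (length vs - 1) * K"
      using \<open>0 \<le> K\<close> by (intro mult_right_mono) auto
    then show ?thesis
      using K[OF pq] by (simp add: path_weight_def)
  qed
  moreover have "paths_between V E p q \<noteq> {}" if "p \<in> M" "q \<in> M" for p q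
    using conn M that unfolding connected_graph_def by blast
  ultimately have "\<rho> p q \<le> graph_dist V E (\<lambda>_. K) p q" if "p \<in> M" "q \<in> M" for p q
    unfolding graph_dist_def
    using that finite_paths_between[OF fin(1)] by (subst Min_ge_iff) auto
  then show ?thesis
    using \<open>0 \<le> K\<close> conn M by (intro exI[of _ "\<lambda>_. K"]) (auto simp: filling_def joins_def)
qed

lemma tours_boundary_tree_nonempty:
  fixes M V :: "'a set"
  assumes "infinite (UNIV :: 'a set)" "finite M" "2 \<le> card M" "boundary_tree M V E"
  shows "tours M V E \<noteq> {}"
proof -
  have "tree_graph V E" "M \<subseteq> V"
    using assms(4) by (auto simp: boundary_tree_def joins_def)
  from binary_refinement[OF assms(1-3) this] show ?thesis
    using tours_boundary_tree[OF assms(4)] by blast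
qed

theorem corollary7p1:
  fixes M :: "'a set" and \<rho> :: "'a \<Rightarrow> 'a \<Rightarrow> real"
  assumes "infinite (UNIV :: 'a set)"
    and "finite M" and "2 \<le> card M" and "pseudo_metric_on M \<rho>"
  shows
    "(\<forall>V E \<omega>. filling M \<rho> V E \<omega> \<and> boundary_tree M V E \<longrightarrow>
        (\<forall>\<pi>\<in>tours M V E. half_perimeter_wrt M \<rho> \<pi> \<le> graph_weight E \<omega>) \<and>
        max_tour_half_perimeter M \<rho> V E \<le> graph_weight E \<omega> \<and>
        (graph_weight E \<omega> = max_tour_half_perimeter M \<rho> V E \<longrightarrow>
           minimal_parametric_filling M \<rho> V E \<omega> \<and>
           mpf M \<rho> V E = max_tour_half_perimeter M \<rho> V E)) \<and>
     minimax_trees M \<rho> \<le> mf M \<rho> \<and>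
     half_perimeter M \<rho> \<le> minimax_trees M \<rho> \<and>
     minimax_binary_trees M \<rho> = minimax_trees M \<rho>"
proof -
  note tours_ne = tours_boundary_tree_nonempty[OF assms(1-3)]
  let ?mx = "max_tour_half_perimeter M \<rho>"
  have tour_le: "half_perimeter_wrt M \<rho> \<pi> \<le> graph_weight E \<omega>"
    if "filling M \<rho> V E \<omega>" "boundary_tree M V E" "\<pi> \<in> tours M V E" for V E \<omega> \<pi>
    using half_perimeter_le_filling[OF that(1) order_refl _ subsetD[OF tours_subset_nontrivial that(3)]]
      that(2) by (simp add: boundary_tree_def)
  then have max_le: "?mx V E \<le> graph_weight E \<omega>"
    if "filling M \<rho> V E \<omega>" "boundary_tree M V E" for V E \<omega>
    using max_tour_le[OF assms(2) tours_ne] that by blast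
  have mpf_eq: "mpf M \<rho> V E = ?mx V E"
    if fill: "filling M \<rho> V E \<omega>" and bt: "boundary_tree M V E"
      and eq: "graph_weight E \<omega> = ?mx V E" for V E \<omega>
    unfolding mpf_def
  proof (rule cInf_eq_minimum)
    show "?mx V E \<in> {graph_weight E \<omega> |\<omega>. filling M \<rho> V E \<omega>}"
      using fill eq[symmetric] by blast
  qed (use max_le bt in blast)

  let ?T = "{?mx V E | V E. boundary_tree M V E}" and ?B = "{?mx V E | V E. binary_tree M V E}"
  have B_T: "?B \<subseteq> ?T"
    using binary_tree_boundary_tree by blast
  \<comment> \<open>All minima are over finite sets: every value is the half-perimeter of some cyclic order.\<close>
  have T_sub: "?T \<subseteq> half_perimeter_wrt M \<rho> ` {\<pi>. cyclic_order M \<pi>}"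
    using max_tour_attained[OF assms(2) tours_ne] tours_subset_cyclic_orders by blast
  have fin_P: "finite (half_perimeter_wrt M \<rho> ` {\<pi>. cyclic_order M \<pi>})"
    using finite_cyclic_orders[OF assms(2)] by simp
  have fin: "finite ?T" "finite ?B"
    using finite_subset[OF T_sub fin_P] finite_subset[OF B_T] by blast+
  \<comment> \<open>Common core of both comparisons with binary trees, with \<open>w\<close> the maximum over the tours of a
    tree in one case and the weight of a filling in the other.\<close>
  have refine: "\<exists>x\<in>?B. x \<le> w"
    if T: "tree_graph V E" "M \<subseteq> V"
      and w: "\<And>\<pi>. \<pi> \<in> tours_nontrivial M V E \<Longrightarrow> half_perimeter_wrt M \<rho> \<pi> \<le> w" for V E w
  proof -
    obtain V' E' where b: "binary_tree M V' E'" "tours M V' E' \<noteq> {}"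
        "tours M V' E' \<subseteq> tours_nontrivial M V E"
      using binary_refinement[OF assms(1-3) T] .
    have "?mx V' E' \<le> w"
      using max_tour_le[OF assms(2) b(2)] b(3) w by blast
    then show ?thesis
      using b(1) by blast
  qed
  obtain r where r: "r \<in> M"
    using assms(3) by fastforce
  \<comment> \<open>The empty family of subsets shows that there is a binary tree with boundary \<open>M\<close> at all.\<close>
  have "\<exists>V E. binary_tree M V E \<and> tours M V E \<noteq> {} \<and>
      (\<forall>C\<in>{}. \<exists>e\<in>E. edge_parts M V E e = {C, M - C})"
    by (rule binary_tree_of_laminar[OF assms(1,2) r]) (use assms(3) in auto)
  then obtain V0 E0 where bin0: "binary_tree M V0 E0"
    by blast
  then have B_ne: "?B \<noteq> {}" and T_ne: "?T \<noteq> {}"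
    using B_T by blast+
  have T_le_B: "Min ?T \<le> Min ?B"
    by (rule Min_antimono[OF B_T B_ne fin(1)])
  have "Min ?B \<le> Min ?T"
  proof -
    obtain V E where VE: "Min ?T = ?mx V E" "boundary_tree M V E"
      using Min_in[OF fin(1) T_ne] by blast
    have "\<exists>x\<in>?B. x \<le> ?mx V E"
    proof (rule refine)
      show "tree_graph V E" "M \<subseteq> V"
        using VE(2) by (auto simp: boundary_tree_def joins_def)
    qed (use le_max_tour[OF assms(2)] tours_boundary_tree[OF VE(2)] in blast)
    then show ?thesis
      unfolding VE(1) using Min_le[OF fin(2)] order_trans by blast
  qed
  then have B_eq: "minimax_binary_trees M \<rho> = minimax_trees M \<rho>"
    using T_le_B by (simp add: minimax_binary_trees_def minimax_trees_def)
  have "minimax_trees M \<rho> \<le> mf M \<rho>"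
    unfolding mf_def
  proof (rule cInf_greatest)
    have "connected_graph V0 E0" "M \<subseteq> V0"
      using binary_tree_boundary_tree[OF bin0] by (auto simp: boundary_tree_def joins_def)
    from filling_exists[OF this assms(4)]
    show "{graph_weight E \<omega> |V E \<omega>. filling M \<rho> V E \<omega>} \<noteq> {}"
      by blast
    fix w assume "w \<in> {graph_weight E \<omega> |V E \<omega>. filling M \<rho> V E \<omega>}"
    then obtain V E \<omega> where w: "w = graph_weight E \<omega>" and fill: "filling M \<rho> V E \<omega>"
      by blast
    then have "connected_graph V E" "M \<subseteq> V"
      by (auto simp: filling_def joins_def)
    obtain F where F: "F \<subseteq> E" "tree_graph V F"
      using spanning_tree[OF \<open>connected_graph V E\<close>] .
    have "\<exists>x\<in>?B. x \<le> w"
      by (rule refine[OF F(2) \<open>M \<subseteq> V\<close>]) (use half_perimeter_le_filling[OF fill F] w in blast)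
    then have "Min ?B \<le> w"
      using Min_le[OF fin(2)] order_trans by blast
    then show "minimax_trees M \<rho> \<le> w"
      using B_eq by (simp add: minimax_binary_trees_def)
  qed
  moreover have "half_perimeter M \<rho> \<le> minimax_trees M \<rho>"
    unfolding half_perimeter_def minimax_trees_def by (rule Min_antimono[OF T_sub T_ne fin_P])
  ultimately show ?thesis
    using tour_le max_le mpf_eq B_eq by (auto simp: minimal_parametric_filling_def)
qed

end
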